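(* Let $F,G$ be first-order sentences such that $F$ is Horn and $F\models G$. Then a Craig-Lyndon interpolant $H$ of $F$ and $G$ can be constructed such that: (1) $H$ is a Horn sentence; (2) if $F$ and $G$ are universal sentences and $\mathrm{fun}(F)\subseteq\mathrm{fun}(G)$, then $H$ is a universal sentence; (3) if $F$ and $G$ are existential sentences and $\mathrm{fun}(G)\subseteq\mathrm{fun}(F)$, then $H$ is an existential sentence.
   Context: First-order logic without equality. $\mathrm{pred}(F)$ is the set of pairs (predicate, polarity) of predicate occurrences in $F$, polarity being positive if the occurrence is in the scope of an even number of negations and negative otherwise; $\mathrm{fun}(F)$ is the set of function symbols (including constants) occurring in $F$. A Craig-Lyndon interpolant of sentences $F,G$ with $F\models G$ is a sentence $H$ with $F\models H\models G$, $\mathrm{pred}(H)\subseteq\mathrm{pred}(F)\cap\mathrm{pred}(G)$ and $\mathrm{fun}(H)\subseteq\mathrm{fun}(F)\cap\mathrm{fun}(G)$. A sentence is universal (existential) if it has the form $\mathbf{Q}F$ with $\mathbf{Q}$ a prefix of only universal (only existential) individual quantifiers and $F$ quantifier-free. A sentence is Horn if it has the form $\mathbf{Q}F$ where $\mathbf{Q}$ is a quantifier prefix and $F$ is a quantifier-free conjunction of clauses (disjunctions of literals) each containing at most one positive literal. *)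

theory Defs
  imports "HOL-Library.Countable_Set"
begin

text \<open>
  First-order logic without equality over named variables. Names of function and predicate symbols
  are taken from arbitrary types \<open>'f\<close> and \<open>'p\<close>; a \<^emph>\<open>symbol\<close> is a name together with its arity
  (the number of arguments it is applied to), so the same name used with two arities is two symbols.
  Implication and equivalence are not primitive, hence polarity is determined by negations alone.
\<close>

datatype 'f tm = Var nat | App 'f "'f tm list"

datatype ('f, 'p) fm =
    Truth
  | Falsity
  | Atom 'p "'f tm list"
  | Neg "('f, 'p) fm"
  | Conj "('f, 'p) fm" "('f, 'p) fm"
  | Disj "('f, 'p) fm" "('f, 'p) fm"
  | Forall nat "('f, 'p) fm"
  | Exists nat "('f, 'p) fm"

fun fv_tm :: "'f tm \<Rightarrow> nat set" where
  "fv_tm (Var x) = {x}"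
| "fv_tm (App f ts) = (\<Union>t\<in>set ts. fv_tm t)"

fun fv :: "('f, 'p) fm \<Rightarrow> nat set" where
  "fv Truth = {}"
| "fv Falsity = {}"
| "fv (Atom p ts) = (\<Union>t\<in>set ts. fv_tm t)"
| "fv (Neg A) = fv A"
| "fv (Conj A B) = fv A \<union> fv B"
| "fv (Disj A B) = fv A \<union> fv B"
| "fv (Forall x A) = fv A - {x}"
| "fv (Exists x A) = fv A - {x}"

definition sentence :: "('f, 'p) fm \<Rightarrow> bool" where
  "sentence A \<longleftrightarrow> fv A = {}"

fun funs_tm :: "'f tm \<Rightarrow> ('f \<times> nat) set" where
  "funs_tm (Var x) = {}"
| "funs_tm (App f ts) = insert (f, length ts) (\<Union>t\<in>set ts. funs_tm t)"

fun funs :: "('f, 'p) fm \<Rightarrow> ('f \<times> nat) set" where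
  "funs Truth = {}"
| "funs Falsity = {}"
| "funs (Atom p ts) = (\<Union>t\<in>set ts. funs_tm t)"
| "funs (Neg A) = funs A"
| "funs (Conj A B) = funs A \<union> funs B"
| "funs (Disj A B) = funs A \<union> funs B"
| "funs (Forall x A) = funs A"
| "funs (Exists x A) = funs A"

text \<open>
  The Boolean argument of \<open>preds_pol\<close> is the polarity of the position of the formula: \<open>True\<close> if it
  is in the scope of an even number of negations.
\<close>

fun preds_pol :: "bool \<Rightarrow> ('f, 'p) fm \<Rightarrow> (('p \<times> nat) \<times> bool) set" where
  "preds_pol b Truth = {}"
| "preds_pol b Falsity = {}"
| "preds_pol b (Atom p ts) = {((p, length ts), b)}"
| "preds_pol b (Neg A) = preds_pol (\<not> b) A"
| "preds_pol b (Conj A B) = preds_pol b A \<union> preds_pol b B"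
| "preds_pol b (Disj A B) = preds_pol b A \<union> preds_pol b B"
| "preds_pol b (Forall x A) = preds_pol b A"
| "preds_pol b (Exists x A) = preds_pol b A"

definition preds :: "('f, 'p) fm \<Rightarrow> (('p \<times> nat) \<times> bool) set" where
  "preds A = preds_pol True A"


text \<open>
  Interpretations have an arbitrary nonempty domain that is a subset of the type \<open>'u\<close>.
\<close>

record ('u, 'f, 'p) interp =
  Dom :: "'u set"
  Fun :: "'f \<Rightarrow> 'u list \<Rightarrow> 'u"
  Rel :: "'p \<Rightarrow> 'u list \<Rightarrow> bool"

definition interpretation_ok :: "('u, 'f, 'p) interp \<Rightarrow> bool" where
  "interpretation_ok M \<longleftrightarrow>
     Dom M \<noteq> {} \<and> (\<forall>f. \<forall>us \<in> lists (Dom M). Fun M f us \<in> Dom M)"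

fun eval :: "('u, 'f, 'p) interp \<Rightarrow> (nat \<Rightarrow> 'u) \<Rightarrow> 'f tm \<Rightarrow> 'u" where
  "eval M e (Var x) = e x"
| "eval M e (App f ts) = Fun M f (map (eval M e) ts)"

fun holds :: "('u, 'f, 'p) interp \<Rightarrow> (nat \<Rightarrow> 'u) \<Rightarrow> ('f, 'p) fm \<Rightarrow> bool" where
  "holds M e Truth \<longleftrightarrow> True"
| "holds M e Falsity \<longleftrightarrow> False"
| "holds M e (Atom p ts) \<longleftrightarrow> Rel M p (map (eval M e) ts)"
| "holds M e (Neg A) \<longleftrightarrow> \<not> holds M e A"
| "holds M e (Conj A B) \<longleftrightarrow> holds M e A \<and> holds M e B"
| "holds M e (Disj A B) \<longleftrightarrow> holds M e A \<or> holds M e B"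
| "holds M e (Forall x A) \<longleftrightarrow> (\<forall>u \<in> Dom M. holds M (e(x := u)) A)"
| "holds M e (Exists x A) \<longleftrightarrow> (\<exists>u \<in> Dom M. holds M (e(x := u)) A)"

text \<open>
  Entailment has to name the type \<open>'u\<close> that domains are drawn from, since HOL cannot quantify over
  types inside a formula. For infinite \<open>'u\<close> it does not depend on this choice and is the usual
  relation of logical consequence: see \<open>entails_all\<close> and \<open>entails_universe\<close> below.
\<close>

definition entails :: "'u itself \<Rightarrow> ('f, 'p) fm \<Rightarrow> ('f, 'p) fm \<Rightarrow> bool" where
  "entails U A B \<longleftrightarrow>
     (\<forall>(M :: ('u, 'f, 'p) interp) e.
        interpretation_ok M \<longrightarrow> range e \<subseteq> Dom M \<longrightarrow> holds M e A \<longrightarrow> holds M e B)"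

definition craig_lyndon_interpolant ::
    "'u itself \<Rightarrow> ('f, 'p) fm \<Rightarrow> ('f, 'p) fm \<Rightarrow> ('f, 'p) fm \<Rightarrow> bool" where
  "craig_lyndon_interpolant U F G H \<longleftrightarrow>
     sentence H \<and> entails U F H \<and> entails U H G \<and>
     preds H \<subseteq> preds F \<inter> preds G \<and> funs H \<subseteq> funs F \<inter> funs G"


fun quantifier_free :: "('f, 'p) fm \<Rightarrow> bool" where
  "quantifier_free (Neg A) \<longleftrightarrow> quantifier_free A"
| "quantifier_free (Conj A B) \<longleftrightarrow> quantifier_free A \<and> quantifier_free B"
| "quantifier_free (Disj A B) \<longleftrightarrow> quantifier_free A \<and> quantifier_free B"
| "quantifier_free (Forall x A) \<longleftrightarrow> False"
| "quantifier_free (Exists x A) \<longleftrightarrow> False"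
| "quantifier_free A \<longleftrightarrow> True"

fun universal_form :: "('f, 'p) fm \<Rightarrow> bool" where
  "universal_form (Forall x A) \<longleftrightarrow> universal_form A"
| "universal_form A \<longleftrightarrow> quantifier_free A"

fun existential_form :: "('f, 'p) fm \<Rightarrow> bool" where
  "existential_form (Exists x A) \<longleftrightarrow> existential_form A"
| "existential_form A \<longleftrightarrow> quantifier_free A"

definition universal_sentence :: "('f, 'p) fm \<Rightarrow> bool" where
  "universal_sentence A \<longleftrightarrow> sentence A \<and> universal_form A"

definition existential_sentence :: "('f, 'p) fm \<Rightarrow> bool" where
  "existential_sentence A \<longleftrightarrow> sentence A \<and> existential_form A"

text \<open>
  \<open>Falsity\<close> is the empty disjunction of literals and \<open>Truth\<close> the empty conjunction of clauses.
  Bracketing of disjunctions and conjunctions is arbitrary.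
\<close>

fun literal :: "('f, 'p) fm \<Rightarrow> bool" where
  "literal (Atom p ts) \<longleftrightarrow> True"
| "literal (Neg (Atom p ts)) \<longleftrightarrow> True"
| "literal A \<longleftrightarrow> False"

fun clause :: "('f, 'p) fm \<Rightarrow> bool" where
  "clause Falsity \<longleftrightarrow> True"
| "clause (Disj A B) \<longleftrightarrow> clause A \<and> clause B"
| "clause A \<longleftrightarrow> literal A"

text \<open>The number of occurrences of positive literals in a clause.\<close>

fun num_positive :: "('f, 'p) fm \<Rightarrow> nat" where
  "num_positive (Atom p ts) = 1"
| "num_positive (Disj A B) = num_positive A + num_positive B"
| "num_positive A = 0"

fun horn_matrix :: "('f, 'p) fm \<Rightarrow> bool" where
  "horn_matrix Truth \<longleftrightarrow> True"
| "horn_matrix (Conj A B) \<longleftrightarrow> horn_matrix A \<and> horn_matrix B"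
| "horn_matrix A \<longleftrightarrow> clause A \<and> num_positive A \<le> 1"

fun horn_form :: "('f, 'p) fm \<Rightarrow> bool" where
  "horn_form (Forall x A) \<longleftrightarrow> horn_form A"
| "horn_form (Exists x A) \<longleftrightarrow> horn_form A"
| "horn_form A \<longleftrightarrow> horn_matrix A"

definition horn_sentence :: "('f, 'p) fm \<Rightarrow> bool" where
  "horn_sentence A \<longleftrightarrow> sentence A \<and> horn_form A"


text \<open>
  Independence of entailment from the universe: a downward Loewenheim-Skolem argument shows that a
  counterexample over any type yields one over every infinite type.
\<close>

fun quant_subs :: "('f, 'p) fm \<Rightarrow> (nat \<times> ('f, 'p) fm) set" where
  "quant_subs (Neg A) = quant_subs A"
| "quant_subs (Conj A B) = quant_subs A \<union> quant_subs B"
| "quant_subs (Disj A B) = quant_subs A \<union> quant_subs B"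
| "quant_subs (Forall x A) = insert (x, Neg A) (quant_subs A)"
| "quant_subs (Exists x A) = insert (x, A) (quant_subs A)"
| "quant_subs A = {}"

lemma finite_quant_subs: "finite (quant_subs A)"
  by (induction A) auto

lemma finite_fv_tm: "finite (fv_tm t)"
  by (induction t) auto

lemma finite_fv: "finite (fv A)"
  by (induction A) (auto simp: finite_fv_tm)

lemma finite_funs_tm: "finite (funs_tm t)"
  by (induction t) auto

lemma finite_funs: "finite (funs A)"
  by (induction A) (auto simp: finite_funs_tm)

lemma eval_cong: "(\<And>x. x \<in> fv_tm t \<Longrightarrow> e x = e' x) \<Longrightarrow> eval M e t = eval M e' t"
proof (induction t)
  case (App f ts)
  then have "map (eval M e) ts = map (eval M e') ts" by (intro map_cong refl) auto
  then show ?case by (simp only: eval.simps)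
qed simp

lemma holds_cong: "(\<And>x. x \<in> fv A \<Longrightarrow> e x = e' x) \<Longrightarrow> holds M e A \<longleftrightarrow> holds M e' A"
proof (induction A arbitrary: e e')
  case (Atom p ts)
  have "map (eval M e) ts = map (eval M e') ts"
    using Atom by (intro map_cong refl eval_cong) auto
  then show ?case by (simp only: holds.simps)
next
  case (Forall x A)
  have "holds M (e(x := u)) A \<longleftrightarrow> holds M (e'(x := u)) A" for u
    by (rule Forall.IH) (use Forall.prems in auto)
  then show ?case by simp
next
  case (Exists x A)
  have "holds M (e(x := u)) A \<longleftrightarrow> holds M (e'(x := u)) A" for u
    by (rule Exists.IH) (use Exists.prems in auto)
  then show ?case by simp
next
  case (Neg A)
  have "holds M e A \<longleftrightarrow> holds M e' A"
    by (rule Neg.IH) (use Neg.prems in simp)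
  then show ?case by simp
next
  case (Conj A B)
  have "holds M e A \<longleftrightarrow> holds M e' A" "holds M e B \<longleftrightarrow> holds M e' B"
    by (rule Conj.IH(1), simp add: Conj.prems) (rule Conj.IH(2), simp add: Conj.prems)
  then show ?case by simp
next
  case (Disj A B)
  have "holds M e A \<longleftrightarrow> holds M e' A" "holds M e B \<longleftrightarrow> holds M e' B"
    by (rule Disj.IH(1), simp add: Disj.prems) (rule Disj.IH(2), simp add: Disj.prems)
  then show ?case by simp
qed simp_all

lemma countable_hull:
  fixes B :: "'v set" and Ops :: "('v list \<Rightarrow> 'v) set"
  assumes "countable B" "countable Ops" "B \<subseteq> D"
    and D: "\<And>g vs. g \<in> Ops \<Longrightarrow> vs \<in> lists D \<Longrightarrow> g vs \<in> D"
  obtains S where "countable S" "B \<subseteq> S" "S \<subseteq> D"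
    "\<And>g vs. g \<in> Ops \<Longrightarrow> vs \<in> lists S \<Longrightarrow> g vs \<in> S"
proof -
  define X where "X = rec_nat B (\<lambda>_ S. S \<union> (\<Union>g\<in>Ops. g ` lists S))"
  have X0: "X 0 = B" and XS: "X (Suc n) = X n \<union> (\<Union>g\<in>Ops. g ` lists (X n))" for n
    by (simp_all add: X_def)
  have cX: "countable (X n)" for n
    by (induction n) (auto simp: X0 XS assms(1,2))
  have XD: "X n \<subseteq> D" for n
  proof (induction n)
    case 0
    show ?case using assms(3) by (simp only: X0)
  next
    case (Suc n)
    have "g vs \<in> D" if "g \<in> Ops" "vs \<in> lists (X n)" for g vs
      by (rule D[OF that(1) subsetD[OF lists_mono[OF Suc.IH] that(2)]])
    with Suc show ?case unfolding XS by (intro Un_least UN_least image_subsetI)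
  qed
  have mono: "m \<le> n \<Longrightarrow> X m \<subseteq> X n" for m n
    by (rule lift_Suc_mono_le[of X]) (simp_all only: XS Un_upper1)
  have level: "\<exists>n. vs \<in> lists (X n)" if "vs \<in> lists (\<Union>n. X n)" for vs
    using that
  proof (induction vs)
    case (Cons v vs)
    then obtain m n where v: "v \<in> X m" and vs: "vs \<in> lists (X n)" by auto
    have "v \<in> X (max m n)" using mono[of m "max m n"] v by (auto simp only: max.cobounded1)
    moreover have "vs \<in> lists (X (max m n))"
      using subsetD[OF lists_mono[OF mono[of n "max m n"]] vs] by simp
    ultimately have "v # vs \<in> lists (X (max m n))" by (rule lists.Cons)
    then show ?case by (rule exI)
  qed auto
  show thesis
  proof
    show "countable (\<Union>n. X n)" using cX by blast
    show "B \<subseteq> (\<Union>n. X n)" using X0 by blast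
    show "(\<Union>n. X n) \<subseteq> D" using XD by blast
    fix g vs assume "g \<in> Ops" "vs \<in> lists (\<Union>n. X n)"
    obtain n where "vs \<in> lists (X n)" using level[OF \<open>vs \<in> lists (\<Union>n. X n)\<close>] by (elim exE)
    then have "g vs \<in> X (Suc n)" unfolding XS using \<open>g \<in> Ops\<close> by blast
    then show "g vs \<in> (\<Union>n. X n)" by blast
  qed
qed

lemma transfer_universe:
  fixes M :: "('v, 'f, 'p) interp" and C :: "('f, 'p) fm"
  assumes inf: "infinite (UNIV :: 'u set)"
    and M: "interpretation_ok M" and e: "range e \<subseteq> Dom M"
  obtains N :: "('u, 'f, 'p) interp" and e'
  where "interpretation_ok N" "range e' \<subseteq> Dom N"
    "\<And>A. funs A \<subseteq> funs C \<Longrightarrow> quant_subs A \<subseteq> quant_subs C \<Longrightarrow> holds N e' A \<longleftrightarrow> holds M e A"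
proof -
  define d where "d = e 0"
  define env where "env vs = (\<lambda>n. if n < length vs then vs ! n else d)" for vs
  define wit where "wit = (\<lambda>(x, A) vs.
    if \<exists>u\<in>Dom M. holds M ((env vs)(x := u)) A
    then SOME u. u \<in> Dom M \<and> holds M ((env vs)(x := u)) A else d)"
  have d: "d \<in> Dom M" using e by (auto simp: d_def)
  have wit_dom: "wit q vs \<in> Dom M" for q vs
    by (cases q) (auto simp: wit_def d intro: someI2_ex)
  have wit: "holds M ((env vs)(x := wit (x, A) vs)) A"
    if "u \<in> Dom M" "holds M ((env vs)(x := u)) A" for x A vs u
    using that someI[of "\<lambda>u. u \<in> Dom M \<and> holds M ((env vs)(x := u)) A" u]
    by (auto simp: wit_def)
  define Ops where "Ops = (Fun M \<circ> fst) ` funs C \<union> wit ` quant_subs C"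
  obtain S where S: "countable S" "range e \<subseteq> S" "S \<subseteq> Dom M"
    and closed: "\<And>g vs. g \<in> Ops \<Longrightarrow> vs \<in> lists S \<Longrightarrow> g vs \<in> S"
  proof (rule countable_hull[of "range e" Ops "Dom M"])
    show "countable Ops"
      unfolding Ops_def
      by (intro countable_finite finite_UnI finite_imageI finite_funs finite_quant_subs)
    show "countable (range e)" by simp
    show "range e \<subseteq> Dom M" by (rule e)
    show "g vs \<in> Dom M" if "g \<in> Ops" "vs \<in> lists (Dom M)" for g vs
    proof -
      have "(\<exists>f. g = Fun M f) \<or> (\<exists>q. g = wit q)" using that(1) by (auto simp: Ops_def)
      then show ?thesis using M wit_dom that(2) by (metis interpretation_ok_def)
    qed
  qed blast
  have closed_fun: "Fun M f vs \<in> S" if "(f, n) \<in> funs C" "vs \<in> lists S" for f n vs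
    using closed[of "Fun M f" vs] that by (force simp: Ops_def)
  have closed_wit: "\<exists>w\<in>S. holds M (a(x := w)) A"
    if q: "(x, A) \<in> quant_subs C" and a: "range a \<subseteq> S"
      and u: "u \<in> Dom M" "holds M (a(x := u)) A" for x A a u
  proof -
    obtain n where n: "\<forall>y\<in>fv A. y < n"
      using finite_nat_set_iff_bounded[of "fv A"] finite_fv by blast
    define vs where "vs = map a [0..<n]"
    have eq: "holds M ((env vs)(x := w)) A \<longleftrightarrow> holds M (a(x := w)) A" for w
      by (rule holds_cong) (use n in \<open>auto simp: env_def vs_def\<close>)
    have "a y \<in> S" for y using a by blast
    then have "vs \<in> lists S" by (auto simp: vs_def)
    then have "wit (x, A) vs \<in> S" using q closed by (auto simp: Ops_def)
    then show ?thesis using wit u eq by blast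
  qed
  obtain i :: "'v \<Rightarrow> nat" where i: "inj_on i S" using S(1) by (auto simp: countable_def)
  obtain j :: "nat \<Rightarrow> 'u" where j: "inj j"
    using infinite_countable_subset[OF inf] by auto
  define h where "h = j \<circ> i"
  have h: "inj_on h S" unfolding h_def using i j by (intro comp_inj_on) (auto intro: inj_on_subset)
  define k where "k = inv_into S h"
  have kh: "k (h v) = v" if "v \<in> S" for v using h that by (simp add: k_def)
  define N :: "('u, 'f, 'p) interp" where
    "N = \<lparr>Dom = h ` S,
      Fun = (\<lambda>f us. let v = Fun M f (map k us) in h (if v \<in> S then v else d)),
      Rel = (\<lambda>p us. Rel M p (map k us))\<rparr>"
  have DomN: "Dom N = h ` S" by (simp add: N_def)
  have dS: "d \<in> S" using S by (auto simp: d_def)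
  have ev: "eval M a t \<in> S \<and> eval N (h \<circ> a) t = h (eval M a t)"
    if "funs_tm t \<subseteq> funs C" "range a \<subseteq> S" for a t
    using that
  proof (induction t)
    case (App f ts)
    have IH: "eval M a t \<in> S \<and> eval N (h \<circ> a) t = h (eval M a t)" if "t \<in> set ts" for t
    proof (rule App.IH[OF that])
      show "funs_tm t \<subseteq> funs C" using App.prems(1) that by auto
    qed (rule App.prems)
    then have m: "map k (map (eval N (h \<circ> a)) ts) = map (eval M a) ts"
      by (simp add: kh)
    have "Fun M f (map (eval M a) ts) \<in> S"
      using App.prems IH by (intro closed_fun[of f "length ts"]) auto
    moreover have "eval N (h \<circ> a) (App f ts) =
        (let v = Fun M f (map k (map (eval N (h \<circ> a)) ts)) in h (if v \<in> S then v else d))"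
      by (simp add: N_def)
    ultimately show ?case unfolding m by (simp only: eval.simps Let_def if_True simp_thms)
  qed auto
  have upd: "(h \<circ> a)(x := h v) = h \<circ> a(x := v)" for a :: "nat \<Rightarrow> 'v" and x v
    by auto
  have main: "holds N (h \<circ> a) A \<longleftrightarrow> holds M a A"
    if "funs A \<subseteq> funs C" "quant_subs A \<subseteq> quant_subs C" "range a \<subseteq> S" for A a
    using that
  proof (induction A arbitrary: a)
    case (Atom p ts)
    have "eval M a t \<in> S \<and> eval N (h \<circ> a) t = h (eval M a t)" if "t \<in> set ts" for t
    proof (rule ev)
      show "funs_tm t \<subseteq> funs C" using Atom.prems(1) that by auto
    qed (rule Atom.prems)
    then have m: "map k (map (eval N (h \<circ> a)) ts) = map (eval M a) ts"
      by (simp add: kh)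
    have "holds N (h \<circ> a) (Atom p ts) \<longleftrightarrow> Rel M p (map k (map (eval N (h \<circ> a)) ts))"
      by (simp add: N_def)
    then show ?case unfolding m by (simp only: holds.simps)
  next
    case (Forall x A)
    have IH: "holds N ((h \<circ> a)(x := h v)) A \<longleftrightarrow> holds M (a(x := v)) A" if "v \<in> S" for v
      unfolding upd
    proof (rule Forall.IH)
      show "range (a(x := v)) \<subseteq> S" using Forall.prems(3) that by (auto simp: image_subset_iff)
    qed (use Forall.prems in auto)
    have "(\<forall>v\<in>S. holds M (a(x := v)) A) \<longleftrightarrow> (\<forall>v\<in>Dom M. holds M (a(x := v)) A)"
    proof
      assume *: "\<forall>v\<in>S. holds M (a(x := v)) A"
      have q: "(x, Neg A) \<in> quant_subs C" using Forall.prems(2) by auto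
      show "\<forall>v\<in>Dom M. holds M (a(x := v)) A"
        using closed_wit[OF q Forall.prems(3)] * by (auto simp only: holds.simps)
    qed (use S(3) in blast)
    moreover have "(\<forall>u\<in>Dom N. holds N ((h \<circ> a)(x := u)) A) \<longleftrightarrow> (\<forall>v\<in>S. holds M (a(x := v)) A)"
      using IH unfolding DomN by blast
    ultimately show ?case by (simp only: holds.simps)
  next
    case (Exists x A)
    have IH: "holds N ((h \<circ> a)(x := h v)) A \<longleftrightarrow> holds M (a(x := v)) A" if "v \<in> S" for v
      unfolding upd
    proof (rule Exists.IH)
      show "range (a(x := v)) \<subseteq> S" using Exists.prems(3) that by (auto simp: image_subset_iff)
    qed (use Exists.prems in auto)
    have "(\<exists>v\<in>S. holds M (a(x := v)) A) \<longleftrightarrow> (\<exists>v\<in>Dom M. holds M (a(x := v)) A)"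
    proof
      assume *: "\<exists>v\<in>Dom M. holds M (a(x := v)) A"
      have q: "(x, A) \<in> quant_subs C" using Exists.prems(2) by auto
      show "\<exists>v\<in>S. holds M (a(x := v)) A"
        using closed_wit[OF q Exists.prems(3)] * by blast
    qed (use S(3) in blast)
    moreover have "(\<exists>u\<in>Dom N. holds N ((h \<circ> a)(x := u)) A) \<longleftrightarrow> (\<exists>v\<in>S. holds M (a(x := v)) A)"
      using IH unfolding DomN by blast
    ultimately show ?case by (simp only: holds.simps)
  qed auto
  show thesis
  proof
    show "interpretation_ok N" using dS by (auto simp: interpretation_ok_def N_def Let_def)
    show "range (h \<circ> e) \<subseteq> Dom N" using S(2) by (auto simp: N_def)
    show "\<And>A. funs A \<subseteq> funs C \<Longrightarrow> quant_subs A \<subseteq> quant_subs C \<Longrightarrow>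
        holds N (h \<circ> e) A \<longleftrightarrow> holds M e A"
      using main S(2) by blast
  qed
qed

theorem entails_all:
  fixes M :: "('v, 'f, 'p) interp"
  assumes inf: "infinite (UNIV :: 'u set)" and AB: "entails TYPE('u) A B"
    and M: "interpretation_ok M" "range e \<subseteq> Dom M" "holds M e A"
  shows "holds M e B"
proof -
  obtain N :: "('u, 'f, 'p) interp" and e'
    where N: "interpretation_ok N" "range e' \<subseteq> Dom N"
      and eq: "\<And>D. funs D \<subseteq> funs (Conj A B) \<Longrightarrow> quant_subs D \<subseteq> quant_subs (Conj A B) \<Longrightarrow>
        holds N e' D \<longleftrightarrow> holds M e D"
    using transfer_universe[OF inf M(1,2), of "Conj A B"] by blast
  show ?thesis using AB N M(3) eq[of A] eq[of B] by (auto simp: entails_def)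
qed

corollary entails_universe:
  assumes "infinite (UNIV :: 'u set)" "infinite (UNIV :: 'v set)"
  shows "entails TYPE('u) A B \<longleftrightarrow> entails TYPE('v) A B"
proof
  assume "entails TYPE('u) A B"
  then show "entails TYPE('v) A B"
    unfolding entails_def[of "TYPE('v)"] by (intro allI impI) (rule entails_all[OF assms(1)])
next
  assume "entails TYPE('v) A B"
  then show "entails TYPE('u) A B"
    unfolding entails_def[of "TYPE('u)"] by (intro allI impI) (rule entails_all[OF assms(2)])
qed

end

theory Submission
  imports Defs "HOL-Analysis.Function_Topology"
begin

text \<open>
  Bring \<open>F\<close> and \<open>G\<close> into prenex form and Skolemize \<open>F\<close> and \<open>\<not> G\<close>. Since no Herbrand interpretation
  satisfies all ground instances of both matrices, by compactness finitely many instances of \<open>F\<close>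
  imply the disjunction of finitely many instances of \<open>G\<close>. Valuations satisfying Horn clauses are
  closed under intersection, hence this implication has a propositional interpolant that is a
  conjunction of Horn clauses over common literals. Replace in it each maximal term whose outermost
  symbol is not common to \<open>F\<close> and \<open>G\<close> by a variable, and quantify the variables in the order of term
  size: existentially if the symbol belongs to \<open>F\<close> or its Skolem functions, universally if it
  belongs to \<open>G\<close>. The matrix remains Horn, and under the hypotheses of (2) and (3) only one of the
  two kinds of terms occurs.
\<close>

section \<open>Propositional interpolation\<close>

definition determined_by :: "'a set \<Rightarrow> (('a \<Rightarrow> bool) \<Rightarrow> bool) \<Rightarrow> bool" where
  "determined_by S \<phi> \<longleftrightarrow> (\<forall>v w. (\<forall>a\<in>S. v a = w a) \<longrightarrow> \<phi> v = \<phi> w)"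

text \<open>By Tychonoff, the product of two-point discrete spaces is compact. The valuations that
  falsify a given \<open>\<phi> i\<close> form an open set because only finitely many coordinates
  matter. These open sets cover the space, and a finite subcover gives \<open>Y\<close>.\<close>

lemma propositional_compactness:
  fixes \<phi> :: "'i \<Rightarrow> ('a \<Rightarrow> bool) \<Rightarrow> bool"
  assumes fin: "\<forall>i\<in>X. \<exists>S. finite S \<and> determined_by S (\<phi> i)"
    and unsat: "\<forall>v. \<exists>i\<in>X. \<not> \<phi> i v"
  shows "\<exists>Y. finite Y \<and> Y \<subseteq> X \<and> (\<forall>v. \<exists>i\<in>Y. \<not> \<phi> i v)"
proof -
  define T where "T = product_topology (\<lambda>_::'a. discrete_topology (UNIV :: bool set)) UNIV"
  have "compact_space T"
    unfolding T_def by (simp add: compact_space_product_topology compact_space_discrete_topology)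
  have top: "topspace T = UNIV" by (simp add: T_def)
  define N where "N i = {v. \<not> \<phi> i v}" for i
  have "openin T (N i)" if i: "i \<in> X" for i
  proof (subst openin_subopen, intro ballI)
    fix v assume v: "v \<in> N i"
    from bspec[OF fin i] obtain S where S: "finite S" "determined_by S (\<phi> i)" by blast
    \<comment> \<open>The cylinder of all valuations that agree with \<open>v\<close> on the finite
      set \<open>S\<close>.\<close>
    define B where "B = Pi\<^sub>E UNIV (\<lambda>a. if a \<in> S then {v a} else UNIV)"
    have "openin T B"
      unfolding T_def B_def using S(1)
      by (intro product_topology_basis) (auto intro: finite_subset)
    moreover have "v \<in> B" by (simp add: B_def PiE_iff)
    moreover have "B \<subseteq> N i"
    proof
      fix w assume "w \<in> B"
      then have "\<forall>a\<in>S. v a = w a" unfolding B_def by (auto simp: PiE_iff split: if_splits)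
      with S(2) v show "w \<in> N i" by (auto simp: determined_by_def N_def)
    qed
    ultimately show "\<exists>B. openin T B \<and> v \<in> B \<and> B \<subseteq> N i" by blast
  qed
  then have "\<And>U. U \<in> N ` X \<Longrightarrow> openin T U" by blast
  moreover have "topspace T \<subseteq> \<Union> (N ` X)" using unsat by (auto simp: N_def)
  ultimately obtain \<F> where \<F>: "finite \<F>" "\<F> \<subseteq> N ` X" "topspace T \<subseteq> \<Union> \<F>"
    using \<open>compact_space T\<close>[unfolded compact_space_alt, rule_format, of "N ` X"] by blast
  from finite_subset_image[OF \<F>(1,2)] obtain Y where Y: "Y \<subseteq> X" "finite Y" "\<F> = N ` Y" by blast
  have "\<forall>v. \<exists>i\<in>Y. \<not> \<phi> i v" using \<F>(3) Y(3) top by (auto simp: N_def)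
  then show ?thesis using Y by (intro exI[of _ Y] conjI)
qed

text \<open>A literal \<open>(a, s)\<close> is true at \<open>v\<close> iff \<open>v a = s\<close>.\<close>

definition preserves :: "('a \<times> bool) set \<Rightarrow> ('a \<Rightarrow> bool) \<Rightarrow> ('a \<Rightarrow> bool) \<Rightarrow> bool" where
  "preserves L v w \<longleftrightarrow> (\<forall>(a, s)\<in>L. v a = s \<longrightarrow> w a = s)"

text \<open>Semantic form of the polarity condition: a formula in negation normal form with all its
  literals in \<open>L\<close> has this property.\<close>

definition lit_mono :: "('a \<times> bool) set \<Rightarrow> (('a \<Rightarrow> bool) \<Rightarrow> bool) \<Rightarrow> bool" where
  "lit_mono L \<phi> \<longleftrightarrow> (\<forall>v w. preserves L v w \<longrightarrow> \<phi> v \<longrightarrow> \<phi> w)"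

lemma lit_monoD:
  "lit_mono L \<phi> \<Longrightarrow> \<phi> v \<Longrightarrow> (\<And>a s. (a, s) \<in> L \<Longrightarrow> v a = s \<Longrightarrow> w a = s) \<Longrightarrow> \<phi> w"
  unfolding lit_mono_def preserves_def by blast

text \<open>The set holds the atoms that occur negated, the option the positive literal if there is
  one.\<close>

type_synonym 'a horn_clause = "'a set \<times> 'a option"

definition sat_clause :: "('a \<Rightarrow> bool) \<Rightarrow> 'a horn_clause \<Rightarrow> bool" where
  "sat_clause v C \<longleftrightarrow> (\<exists>a\<in>fst C. \<not> v a) \<or> (\<exists>a\<in>set_option (snd C). v a)"

definition clause_lits :: "'a horn_clause \<Rightarrow> ('a \<times> bool) set" where
  "clause_lits C = fst C \<times> {False} \<union> set_option (snd C) \<times> {True}"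

text \<open>
  The interpolant consists of all Horn clauses over common literals that \<open>\<phi>\<close> implies. If \<open>v\<close>
  satisfies them, let \<open>w\<close> be the least model of \<open>\<phi>\<close> in which all common negated atoms that are true
  at \<open>v\<close> are true. Mixing \<open>w\<close> and \<open>v\<close> yields \<open>u\<close> such that truth of \<open>\<phi>\<close> transfers from
  \<open>w\<close> to \<open>u\<close> and truth of \<open>\<psi>\<close> from \<open>u\<close> to \<open>v\<close>.
\<close>

lemma propositional_horn_interpolation:
  assumes \<phi>: "lit_mono K \<phi>" and \<psi>: "lit_mono L \<psi>" and K: "finite K"
    and inter: "\<forall>V. V \<noteq> {} \<longrightarrow> (\<forall>v\<in>V. \<phi> v) \<longrightarrow> \<phi> (\<lambda>a. \<forall>v\<in>V. v a)"
    and imp: "\<forall>v. \<phi> v \<longrightarrow> \<psi> v"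
  shows "\<exists>\<C>. finite \<C> \<and> (\<forall>C\<in>\<C>. clause_lits C \<subseteq> K \<inter> L \<and> (\<forall>v. \<phi> v \<longrightarrow> sat_clause v C)) \<and>
    (\<forall>v. (\<forall>C\<in>\<C>. sat_clause v C) \<longrightarrow> \<psi> v)"
proof -
  define \<C> where "\<C> = {C. clause_lits C \<subseteq> K \<inter> L \<and> (\<forall>v. \<phi> v \<longrightarrow> sat_clause v C)}"
  have "\<C> \<subseteq> Pow (fst ` K) \<times> insert None (Some ` fst ` K)"
  proof
    fix C assume "C \<in> \<C>"
    then have C: "clause_lits C \<subseteq> K" by (auto simp: \<C>_def)
    have "fst C \<subseteq> fst ` K"
      using C by (auto simp: clause_lits_def intro!: image_eqI[of _ fst "(_, False)"])
    moreover have "snd C \<in> insert None (Some ` fst ` K)"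
    proof (cases "snd C")
      case (Some a)
      then have "(a, True) \<in> K" using C by (auto simp: clause_lits_def)
      then show ?thesis using Some image_eqI[of a fst "(a, True)" K] by auto
    qed simp
    ultimately show "C \<in> Pow (fst ` K) \<times> insert None (Some ` fst ` K)"
      by (simp add: mem_Times_iff)
  qed
  then have fin: "finite \<C>" by (rule finite_subset) (use K in auto)
  have "\<psi> v" if v: "\<And>C. C \<in> \<C> \<Longrightarrow> sat_clause v C" for v
  proof -
    define N where "N = {a. (a, False) \<in> K \<inter> L \<and> v a}"
    define V where "V = {w. \<phi> w \<and> (\<forall>a\<in>N. w a)}"
    define w where "w = (\<lambda>a. \<forall>w\<in>V. w a)"
    \<comment> \<open>Otherwise every model of \<open>\<phi>\<close> falsifies an atom of
      \<open>N\<close>, so the clause negating all of \<open>N\<close> belongs to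
      \<open>\<C>\<close>, although \<open>v\<close> falsifies it.\<close>
    have "V \<noteq> {}"
    proof
      assume "V = {}"
      then have "(N, None) \<in> \<C>"
        by (auto simp: \<C>_def V_def N_def clause_lits_def sat_clause_def)
      from v[OF this] show False by (auto simp: sat_clause_def N_def)
    qed
    moreover have "\<forall>v\<in>V. \<phi> v" by (simp add: V_def)
    ultimately have w: "\<phi> w" unfolding w_def by (rule inter[THEN spec, THEN mp, THEN mp])
    have neg: "w a" if "(a, False) \<in> K \<inter> L" "v a" for a
      using that by (auto simp: w_def V_def N_def)
    have pos: "v a" if "(a, True) \<in> K \<inter> L" "w a" for a
    proof -
      \<comment> \<open>A model of \<open>\<phi>\<close> that makes \<open>N\<close> true lies in
        \<open>V\<close> and hence makes \<open>a\<close> true. As \<open>N\<close> is true at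
        \<open>v\<close>, this clause forces \<open>a\<close> at \<open>v\<close>.\<close>
      have "(N, Some a) \<in> \<C>"
        using that by (auto simp: \<C>_def V_def N_def w_def clause_lits_def sat_clause_def)
      from v[OF this] show ?thesis by (auto simp: sat_clause_def N_def)
    qed
    \<comment> \<open>All literals of \<open>K\<close> true at \<open>w\<close> stay true at
      \<open>u\<close>. A literal of \<open>L\<close> true at \<open>u\<close> either agrees with
      \<open>v\<close> already or is a common literal true at \<open>w\<close>, where
      \<open>pos\<close> and \<open>neg\<close> apply.\<close>
    define u where "u = (\<lambda>a. if (a, w a) \<in> K then w a else v a)"
    have "\<phi> u"
      by (rule lit_monoD[OF \<phi> w]) (auto simp: u_def)
    then have "\<psi> u" using imp by blast
    then show ?thesis
    proof (rule lit_monoD[OF \<psi>])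
      fix a s assume "(a, s) \<in> L" "u a = s"
      then show "v a = s"
        using pos[of a] neg[of a] by (cases s) (auto simp: u_def split: if_splits)
    qed
  qed
  then have "\<forall>v. (\<forall>C\<in>\<C>. sat_clause v C) \<longrightarrow> \<psi> v" by blast
  moreover have "\<forall>C\<in>\<C>. clause_lits C \<subseteq> K \<inter> L \<and> (\<forall>v. \<phi> v \<longrightarrow> sat_clause v C)"
    by (simp add: \<C>_def)
  ultimately show ?thesis using fin by (intro exI[of _ \<C>] conjI)
qed

section \<open>Prenex form\<close>

text \<open>
  A prenex formula is a list of quantifiers (\<open>True\<close> for universal) together with a matrix in which
  the variable \<open>i\<close> is bound by the quantifier at position \<open>i\<close>. Assignments are lists.
\<close>

fun quantified :: "'u set \<Rightarrow> bool list \<Rightarrow> ('u list \<Rightarrow> bool) \<Rightarrow> 'u list \<Rightarrow> bool" where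
  "quantified D [] \<phi> us \<longleftrightarrow> \<phi> us"
| "quantified D (b # P) \<phi> us \<longleftrightarrow>
    (if b then \<forall>u\<in>D. quantified D P \<phi> (us @ [u]) else \<exists>u\<in>D. quantified D P \<phi> (us @ [u]))"

lemma quantified_cong:
  "(\<And>vs. length vs = length P \<Longrightarrow> \<phi> (us @ vs) = \<psi> (us @ vs)) \<Longrightarrow>
    quantified D P \<phi> us = quantified D P \<psi> us"
proof (induction P arbitrary: us)
  case Nil
  then show ?case using Nil[of "[]"] by simp
next
  case (Cons b P)
  have "quantified D P \<phi> (us @ [u]) = quantified D P \<psi> (us @ [u])" for u
    by (rule Cons.IH) (use Cons.prems[of "u # _"] in simp)
  then show ?case by simp
qed

lemma quantified_append: "quantified D (P @ Q) \<phi> us = quantified D P (quantified D Q \<phi>) us"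
  by (induction P arbitrary: us) auto

lemma quantified_not: "quantified D (map Not P) (\<lambda>vs. \<not> \<phi> vs) us \<longleftrightarrow> \<not> quantified D P \<phi> us"
  by (induction P arbitrary: us) auto

lemma quantified_conj_const:
  "D \<noteq> {} \<Longrightarrow> quantified D P (\<lambda>vs. \<phi> vs \<and> c) us \<longleftrightarrow> quantified D P \<phi> us \<and> c"
  by (induction P arbitrary: us) auto

lemma quantified_disj_const:
  "D \<noteq> {} \<Longrightarrow> quantified D P (\<lambda>vs. \<phi> vs \<or> c) us \<longleftrightarrow> quantified D P \<phi> us \<or> c"
  by (induction P arbitrary: us) auto

text \<open>\<open>\<phi>\<close> does not read the values bound by \<open>Q\<close>, and the value
  \<open>c\<close> of the quantified \<open>\<psi>\<close> does not depend on those bound by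
  \<open>P\<close>. So each operand is constant for the quantifiers of the other and can be moved
  across them, the domain being nonempty.\<close>

lemma quantified_conj_disj:
  assumes D: "D \<noteq> {}" and "length us = k"
    and \<phi>: "\<And>vs ws. length vs = k + length P \<Longrightarrow> \<phi> (vs @ ws) = \<phi> vs"
    and \<psi>: "\<And>vs. length vs = k + length P \<Longrightarrow> take k vs = us \<Longrightarrow> quantified D Q \<psi> vs = c"
  shows "quantified D (P @ Q) (\<lambda>vs. \<phi> vs \<and> \<psi> vs) us \<longleftrightarrow> quantified D P \<phi> us \<and> c"
    and "quantified D (P @ Q) (\<lambda>vs. \<phi> vs \<or> \<psi> vs) us \<longleftrightarrow> quantified D P \<phi> us \<or> c"
proof -
  have "quantified D Q (\<lambda>vs. \<phi> vs \<and> \<psi> vs) vs = (\<phi> vs \<and> c) \<and>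
      quantified D Q (\<lambda>vs. \<phi> vs \<or> \<psi> vs) vs = (\<phi> vs \<or> c)"
    if "length vs = k + length P" "take k vs = us" for vs
  proof -
    have "quantified D Q (\<lambda>vs. \<phi> vs \<and> \<psi> vs) vs = quantified D Q (\<lambda>ws. \<psi> ws \<and> \<phi> vs) vs"
         "quantified D Q (\<lambda>vs. \<phi> vs \<or> \<psi> vs) vs = quantified D Q (\<lambda>ws. \<psi> ws \<or> \<phi> vs) vs"
      by (rule quantified_cong; auto simp: \<phi>[OF that(1)])+
    then show ?thesis
      using \<psi>[OF that] by (auto simp: quantified_conj_const[OF D] quantified_disj_const[OF D])
  qed
  then have "quantified D P (quantified D Q (\<lambda>vs. \<phi> vs \<and> \<psi> vs)) us =
        quantified D P (\<lambda>vs. \<phi> vs \<and> c) us"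
      "quantified D P (quantified D Q (\<lambda>vs. \<phi> vs \<or> \<psi> vs)) us =
        quantified D P (\<lambda>vs. \<phi> vs \<or> c) us"
    using \<open>length us = k\<close> by (auto intro!: quantified_cong)
  then show "quantified D (P @ Q) (\<lambda>vs. \<phi> vs \<and> \<psi> vs) us \<longleftrightarrow> quantified D P \<phi> us \<and> c"
    and "quantified D (P @ Q) (\<lambda>vs. \<phi> vs \<or> \<psi> vs) us \<longleftrightarrow> quantified D P \<phi> us \<or> c"
    by (simp_all add: quantified_append quantified_conj_const[OF D] quantified_disj_const[OF D])
qed

fun rename_tm :: "(nat \<Rightarrow> nat) \<Rightarrow> 'f tm \<Rightarrow> 'f tm" where
  "rename_tm \<rho> (Var x) = Var (\<rho> x)"
| "rename_tm \<rho> (App f ts) = App f (map (rename_tm \<rho>) ts)"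

lemma fv_rename_tm: "fv_tm (rename_tm \<rho> t) = \<rho> ` fv_tm t"
  by (induction t) auto

lemma funs_rename_tm: "funs_tm (rename_tm \<rho> t) = funs_tm t"
  by (induction t) auto

lemma eval_rename_tm: "eval I e (rename_tm \<rho> t) = eval I (e \<circ> \<rho>) t"
  by (induction t) (auto intro!: arg_cong[of _ _ "Fun I _"])

text \<open>The variables bound in the result of \<open>prenex \<rho> k A\<close> are \<open>k, k + 1, \<dots>\<close>.\<close>

fun prenex :: "(nat \<Rightarrow> nat) \<Rightarrow> nat \<Rightarrow> ('f, 'p) fm \<Rightarrow> bool list \<times> ('f, 'p) fm" where
  "prenex \<rho> k Truth = ([], Truth)"
| "prenex \<rho> k Falsity = ([], Falsity)"
| "prenex \<rho> k (Atom p ts) = ([], Atom p (map (rename_tm \<rho>) ts))"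
| "prenex \<rho> k (Neg A) = (let (P, M) = prenex \<rho> k A in (map Not P, Neg M))"
| "prenex \<rho> k (Conj A B) =
    (let (P, M) = prenex \<rho> k A; (Q, N) = prenex \<rho> (k + length P) B in (P @ Q, Conj M N))"
| "prenex \<rho> k (Disj A B) =
    (let (P, M) = prenex \<rho> k A; (Q, N) = prenex \<rho> (k + length P) B in (P @ Q, Disj M N))"
| "prenex \<rho> k (Forall x A) = (let (P, M) = prenex (\<rho>(x := k)) (Suc k) A in (True # P, M))"
| "prenex \<rho> k (Exists x A) = (let (P, M) = prenex (\<rho>(x := k)) (Suc k) A in (False # P, M))"

lemma prenex_syntax:
  "quantifier_free (snd (prenex \<rho> k A))"
  "preds_pol b (snd (prenex \<rho> k A)) = preds_pol b A"
  "funs (snd (prenex \<rho> k A)) = funs A"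
  "quantifier_free A \<Longrightarrow> fst (prenex \<rho> k A) = []"
  by (induction A arbitrary: \<rho> k b) (auto simp: Let_def case_prod_unfold funs_rename_tm)

lemma prenex_universal: "universal_form A \<Longrightarrow> set (fst (prenex \<rho> k A)) \<subseteq> {True}"
  by (induction A arbitrary: \<rho> k rule: universal_form.induct)
    (auto simp: Let_def case_prod_unfold prenex_syntax(4))

lemma prenex_existential: "existential_form A \<Longrightarrow> set (fst (prenex \<rho> k A)) \<subseteq> {False}"
  by (induction A arbitrary: \<rho> k rule: existential_form.induct)
    (auto simp: Let_def case_prod_unfold prenex_syntax(4))

lemma prenex_literal:
  assumes "literal A"
  shows "literal (snd (prenex \<rho> k A)) \<and> num_positive (snd (prenex \<rho> k A)) = num_positive A"
  using assms by (cases A rule: literal.cases) (auto simp: Let_def case_prod_unfold)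

lemma clause_literal: "literal A \<Longrightarrow> clause A"
  by (cases A rule: literal.cases) auto

lemma horn_matrix_clause: "clause A \<Longrightarrow> num_positive A \<le> 1 \<Longrightarrow> horn_matrix A"
  by (cases A rule: horn_matrix.cases) auto

lemma prenex_clause:
  "clause A \<Longrightarrow>
    clause (snd (prenex \<rho> k A)) \<and> num_positive (snd (prenex \<rho> k A)) = num_positive A"
proof (induction A arbitrary: \<rho> k)
  case (Neg A)
  then have "literal (Neg A)" by simp
  from clause_literal prenex_literal[OF this] show ?case by blast
qed (auto simp: Let_def case_prod_unfold)

lemma prenex_horn_matrix: "horn_matrix A \<Longrightarrow> horn_matrix (snd (prenex \<rho> k A))"
proof (induction A arbitrary: \<rho> k)
  case (Neg A)
  then show ?case
    using prenex_clause[of "Neg A" \<rho> k] horn_matrix_clause by (metis horn_matrix.simps(5))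
next
  case (Disj A B)
  then show ?case
    using prenex_clause[of "Disj A B" \<rho> k] horn_matrix_clause by (metis horn_matrix.simps(6))
qed (auto simp: Let_def case_prod_unfold)

text \<open>A Horn form has its quantifiers in front already, so \<open>prenex\<close> merely
  renames variables in its matrix.\<close>

lemma prenex_horn: "horn_form A \<Longrightarrow> horn_matrix (snd (prenex \<rho> k A))"
  by (induction A arbitrary: \<rho> k rule: horn_form.induct)
    (simp_all add: Let_def case_prod_unfold prenex_horn_matrix del: prenex.simps(1-6))

lemma prenex_fv:
  assumes "\<rho> ` fv A \<subseteq> {..<k}"
  shows "fv (snd (prenex \<rho> k A)) \<subseteq> {..<k + length (fst (prenex \<rho> k A))}"
  using assms
proof (induction A arbitrary: \<rho> k)
  case (Atom p ts)
  then show ?case by (auto simp: fv_rename_tm)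
next
  case (Conj A B)
  let ?k = "k + length (fst (prenex \<rho> k A))"
  have "\<rho> ` fv A \<subseteq> {..<k}" "\<rho> ` fv B \<subseteq> {..<k}" using Conj.prems by auto
  moreover from this(2) have "\<rho> ` fv B \<subseteq> {..<?k}" by fastforce
  ultimately show ?case
    using Conj.IH(1)[of \<rho> k] Conj.IH(2)[of \<rho> ?k]
    by (auto simp: Let_def case_prod_unfold)
next
  case (Disj A B)
  let ?k = "k + length (fst (prenex \<rho> k A))"
  have "\<rho> ` fv A \<subseteq> {..<k}" "\<rho> ` fv B \<subseteq> {..<k}" using Disj.prems by auto
  moreover from this(2) have "\<rho> ` fv B \<subseteq> {..<?k}" by fastforce
  ultimately show ?case
    using Disj.IH(1)[of \<rho> k] Disj.IH(2)[of \<rho> ?k]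
    by (auto simp: Let_def case_prod_unfold)
next
  case (Forall x A)
  have "(\<rho>(x := k)) ` fv A \<subseteq> {..<Suc k}" using Forall.prems by (auto simp: less_Suc_eq)
  from Forall.IH[OF this] show ?case by (simp add: Let_def case_prod_unfold del: fun_upd_apply)
next
  case (Exists x A)
  have "(\<rho>(x := k)) ` fv A \<subseteq> {..<Suc k}" using Exists.prems by (auto simp: less_Suc_eq)
  from Exists.IH[OF this] show ?case by (simp add: Let_def case_prod_unfold del: fun_upd_apply)
qed (auto simp: Let_def case_prod_unfold)

text \<open>The common part of two cases of the induction for \<open>prenex_holds\<close>, with the
  induction hypotheses as assumptions. They range over all \<open>k\<close> because the variables
  bound in the right operand are numbered after those of the left one.\<close>

lemma prenex_holds_binary:
  fixes A B :: "('f, 'p) fm"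
  defines "sem \<equiv> \<lambda>I (P, M) us. quantified (Dom I) P (\<lambda>vs. holds I ((!) vs) M) us"
  assumes "Dom I \<noteq> {}" "\<rho> ` (fv A \<union> fv B) \<subseteq> {..<k}" "length us = k"
    and IH: "\<And>k us. \<rho> ` fv A \<subseteq> {..<k} \<Longrightarrow> length us = k \<Longrightarrow>
        sem I (prenex \<rho> k A) us \<longleftrightarrow> holds I (\<lambda>x. us ! \<rho> x) A"
      "\<And>k us. \<rho> ` fv B \<subseteq> {..<k} \<Longrightarrow> length us = k \<Longrightarrow>
        sem I (prenex \<rho> k B) us \<longleftrightarrow> holds I (\<lambda>x. us ! \<rho> x) B"
  shows "sem I (prenex \<rho> k (Conj A B)) us \<longleftrightarrow>
      holds I (\<lambda>x. us ! \<rho> x) A \<and> holds I (\<lambda>x. us ! \<rho> x) B"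
    and "sem I (prenex \<rho> k (Disj A B)) us \<longleftrightarrow>
      holds I (\<lambda>x. us ! \<rho> x) A \<or> holds I (\<lambda>x. us ! \<rho> x) B"
proof -
  obtain P M where PM: "prenex \<rho> k A = (P, M)" by (cases "prenex \<rho> k A")
  obtain Q N where QN: "prenex \<rho> (k + length P) B = (Q, N)" by (cases "prenex \<rho> (k + length P) B")
  have A: "\<rho> ` fv A \<subseteq> {..<k}" and B: "\<rho> ` fv B \<subseteq> {..<k}" using assms(3) by auto
  have M: "holds I ((!) (vs @ ws)) M = holds I ((!) vs) M" if "length vs = k + length P" for vs ws
    using prenex_fv[OF A] PM that by (intro holds_cong) (auto simp: nth_append)
  have N: "quantified (Dom I) Q (\<lambda>vs. holds I ((!) vs) N) vs = holds I (\<lambda>x. us ! \<rho> x) B"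
    if vs: "length vs = k + length P" "take k vs = us" for vs
  proof -
    have "vs ! \<rho> x = us ! \<rho> x" if "x \<in> fv B" for x
    proof -
      have "\<rho> x < k" using B that by auto
      then show ?thesis using nth_take[of "\<rho> x" k vs] by (simp only: vs(2))
    qed
    then have "holds I (\<lambda>x. vs ! \<rho> x) B = holds I (\<lambda>x. us ! \<rho> x) B" by (rule holds_cong)
    moreover have "\<rho> ` fv B \<subseteq> {..<k + length P}"
      by (rule order_trans[OF B]) simp
    ultimately show ?thesis using IH(2)[OF _ vs(1)] QN by (simp add: sem_def)
  qed
  note binary = quantified_conj_disj[OF assms(2,4) M N, of P]
  have M_holds: "quantified (Dom I) P (\<lambda>vs. holds I ((!) vs) M) us = holds I (\<lambda>x. us ! \<rho> x) A"
    using IH(1)[OF A assms(4)] PM by (simp add: sem_def)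
  show "sem I (prenex \<rho> k (Conj A B)) us \<longleftrightarrow>
      holds I (\<lambda>x. us ! \<rho> x) A \<and> holds I (\<lambda>x. us ! \<rho> x) B"
    and "sem I (prenex \<rho> k (Disj A B)) us \<longleftrightarrow>
      holds I (\<lambda>x. us ! \<rho> x) A \<or> holds I (\<lambda>x. us ! \<rho> x) B"
    by (simp_all only: sem_def PM QN prenex.simps Let_def prod.case holds.simps binary M_holds)
qed

text \<open>The list \<open>us\<close> carries the values bound so far, and \<open>\<rho>\<close>
  gives the position at which to look up a free variable of \<open>A\<close>. A quantifier appends
  its value at position \<open>k\<close>, which is the update made to \<open>\<rho>\<close>.\<close>

lemma prenex_holds:
  assumes "Dom I \<noteq> {}" "\<rho> ` fv A \<subseteq> {..<k}" "length us = k"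
  shows "quantified (Dom I) (fst (prenex \<rho> k A)) (\<lambda>vs. holds I ((!) vs) (snd (prenex \<rho> k A))) us
    \<longleftrightarrow> holds I (\<lambda>x. us ! \<rho> x) A"
  using assms(2,3)
proof (induction A arbitrary: \<rho> k us)
  case (Atom p ts)
  show ?case by (simp add: eval_rename_tm comp_def)
next
  case (Neg A)
  then show ?case by (simp add: Let_def case_prod_unfold quantified_not)
next
  case (Conj A B)
  then show ?case
    using prenex_holds_binary(1)[OF assms(1), of \<rho> A B k us] by (simp add: Let_def case_prod_unfold)
next
  case (Disj A B)
  then show ?case
    using prenex_holds_binary(2)[OF assms(1), of \<rho> A B k us] by (simp add: Let_def case_prod_unfold)
next
  case (Forall x A)
  have "quantified (Dom I) (fst (prenex (\<rho>(x := k)) (Suc k) A))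
      (\<lambda>vs. holds I ((!) vs) (snd (prenex (\<rho>(x := k)) (Suc k) A))) (us @ [u]) \<longleftrightarrow>
      holds I ((\<lambda>y. us ! \<rho> y)(x := u)) A" for u
  proof -
    have "(\<rho>(x := k)) ` fv A \<subseteq> {..<Suc k}" using Forall.prems by (auto simp: less_Suc_eq)
    moreover have "holds I (\<lambda>y. (us @ [u]) ! (\<rho>(x := k)) y) A = holds I ((\<lambda>y. us ! \<rho> y)(x := u)) A"
      by (rule holds_cong) (use Forall.prems in \<open>auto simp: nth_append\<close>)
    ultimately show ?thesis
      using Forall.IH[of "\<rho>(x := k)" "Suc k" "us @ [u]"] Forall.prems(2)
      by (simp del: fun_upd_apply)
  qed
  then show ?case by (simp add: Let_def case_prod_unfold)
next
  case (Exists x A)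
  have "quantified (Dom I) (fst (prenex (\<rho>(x := k)) (Suc k) A))
      (\<lambda>vs. holds I ((!) vs) (snd (prenex (\<rho>(x := k)) (Suc k) A))) (us @ [u]) \<longleftrightarrow>
      holds I ((\<lambda>y. us ! \<rho> y)(x := u)) A" for u
  proof -
    have "(\<rho>(x := k)) ` fv A \<subseteq> {..<Suc k}" using Exists.prems by (auto simp: less_Suc_eq)
    moreover have "holds I (\<lambda>y. (us @ [u]) ! (\<rho>(x := k)) y) A = holds I ((\<lambda>y. us ! \<rho> y)(x := u)) A"
      by (rule holds_cong) (use Exists.prems in \<open>auto simp: nth_append\<close>)
    ultimately show ?thesis
      using Exists.IH[of "\<rho>(x := k)" "Suc k" "us @ [u]"] Exists.prems(2)
      by (simp del: fun_upd_apply)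
  qed
  then show ?case by (simp add: Let_def case_prod_unfold)
qed simp_all

section \<open>Skolemization and Herbrand interpretations\<close>

text \<open>
  \<open>Inr (s, i)\<close> is the Skolem function for position \<open>i\<close> of the quantifier prefix on side \<open>s\<close>
  (\<open>True\<close> for \<open>F\<close>, \<open>False\<close> for \<open>\<not> G\<close>). It takes all earlier positions as arguments.
\<close>

type_synonym 'f sk = "'f + bool \<times> nat"

text \<open>These lists are the substitutions that yield the instances of the Skolemized matrix:
  terms at universal positions are arbitrary, the others are determined.\<close>

definition skolem_list :: "bool \<Rightarrow> bool list \<Rightarrow> 'f sk tm list \<Rightarrow> bool" where
  "skolem_list s P ts \<longleftrightarrow> length ts = length P \<and>
    (\<forall>i<length P. \<not> P ! i \<longrightarrow> ts ! i = App (Inr (s, i)) (take i ts))"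

text \<open>Over a domain of terms, the Skolem term of the values chosen so far is the witness at
  each existential position. The induction is over the remaining quantifiers \<open>Q\<close>, with
  \<open>us\<close> the values for the part \<open>R\<close> already processed.\<close>

lemma quantified_herbrand:
  assumes "\<And>ts. skolem_list s P ts \<Longrightarrow> \<phi> ts"
  shows "quantified UNIV P \<phi> []"
proof -
  have "quantified UNIV Q \<phi> us"
    if "P = R @ Q" "length us = length R"
      "\<forall>i<length us. \<not> P ! i \<longrightarrow> us ! i = App (Inr (s, i)) (take i us)" for Q R us
    using that
  proof (induction Q arbitrary: R us)
    case Nil
    then show ?case using assms by (simp add: skolem_list_def)
  next
    case (Cons b Q)
    have step: "quantified UNIV Q \<phi> (us @ [u])" if "\<not> b \<longrightarrow> u = App (Inr (s, length us)) us" for u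
      by (rule Cons.IH[of "R @ [b]"])
        (use that Cons.prems in \<open>auto simp: nth_append less_Suc_eq\<close>)
    show ?case
    proof (cases b)
      case False
      then have "quantified UNIV Q \<phi> (us @ [App (Inr (s, length us)) us])" by (intro step) simp
      then show ?thesis using False by auto
    qed (use step in auto)
  qed
  from this[of "[]" P "[]"] show ?thesis by simp
qed

text \<open>\<open>S\<close> chooses witnesses. Along a list that obeys \<open>S\<close>, truth of
  the remaining quantified formula is kept from each position to the next, down to the
  matrix.\<close>

lemma quantified_skolem:
  assumes "D \<noteq> {}" "quantified D P \<phi> []"
  obtains S where "\<And>i us. S i us \<in> D"
    "\<And>us. length us = length P \<Longrightarrow> set us \<subseteq> D \<Longrightarrow>
      (\<And>i. i < length P \<Longrightarrow> \<not> P ! i \<Longrightarrow> us ! i = S i (take i us)) \<Longrightarrow> \<phi> us"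
proof -
  define \<chi> where "\<chi> i us u \<longleftrightarrow> u \<in> D \<and> quantified D (drop (Suc i) P) \<phi> (us @ [u])" for i us u
  \<comment> \<open>Where there is no witness, any element of \<open>D\<close> is taken, so that all
    values of \<open>S\<close> stay in \<open>D\<close>.\<close>
  define S where "S i us = (if \<exists>u. \<chi> i us u then SOME u. \<chi> i us u else SOME u. u \<in> D)" for i us
  have S: "\<chi> i us (S i us)" if "\<chi> i us u" for i us u
    using someI[of "\<chi> i us" u] that by (auto simp: S_def)
  have SD: "S i us \<in> D" for i us
  proof (cases "\<exists>u. \<chi> i us u")
    case True
    then have "\<chi> i us (S i us)" using S by blast
    then show ?thesis by (simp add: \<chi>_def)
  next
    case False
    then show ?thesis using assms(1) some_in_eq[of D] by (simp add: S_def)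
  qed
  have "\<phi> us"
    if us: "length us = length P" "set us \<subseteq> D"
      "\<And>i. i < length P \<Longrightarrow> \<not> P ! i \<Longrightarrow> us ! i = S i (take i us)" for us
  proof -
    have "quantified D (drop i P) \<phi> (take i us)" if "i \<le> length P" for i
      using that
    proof (induction i)
      case 0
      then show ?case using assms(2) by simp
    next
      case (Suc i)
      then have i: "i < length P" by simp
      then have IH: "quantified D (P ! i # drop (Suc i) P) \<phi> (take i us)"
        using Suc.IH by (simp add: Cons_nth_drop_Suc)
      have snoc: "take (Suc i) us = take i us @ [us ! i]"
        using i us(1) by (simp add: take_Suc_conv_app_nth)
      show ?case
      proof (cases "P ! i")
        case True
        have "us ! i \<in> D" using i us(1,2) nth_mem[of i us] by auto
        then show ?thesis using IH True unfolding snoc by simp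
      next
        case False
        then obtain u where "\<chi> i (take i us) u" using IH by (auto simp: \<chi>_def)
        then have "\<chi> i (take i us) (us ! i)" using S us(3)[OF i False] by simp
        then show ?thesis unfolding snoc by (simp add: \<chi>_def)
      qed
    qed
    from this[of "length P"] show ?thesis using us(1) by simp
  qed
  with SD show thesis by (rule that)
qed

text \<open>Skolem functions are not interpreted; they only enlarge the domain, in which variables
  count as additional constants.\<close>

definition herbrand :: "('p \<times> 'f sk tm list \<Rightarrow> bool) \<Rightarrow> ('f sk tm, 'f, 'p) interp" where
  "herbrand v = \<lparr>Dom = UNIV, Fun = (\<lambda>f. App (Inl f)), Rel = (\<lambda>p ts. v (p, ts))\<rparr>"

lemma herbrand_ok: "interpretation_ok (herbrand v)"
  by (simp add: interpretation_ok_def herbrand_def)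

fun inst :: "(nat \<Rightarrow> 'f sk tm) \<Rightarrow> 'f tm \<Rightarrow> 'f sk tm" where
  "inst \<sigma> (Var x) = \<sigma> x"
| "inst \<sigma> (App f ts) = App (Inl f) (map (inst \<sigma>) ts)"

lemma eval_herbrand: "eval (herbrand v) \<sigma> t = inst \<sigma> t"
  by (induction t) (auto simp: herbrand_def)

lemma holds_herbrand_Atom: "holds (herbrand v) \<sigma> (Atom p ts) \<longleftrightarrow> v (p, map (inst \<sigma>) ts)"
proof -
  have "map (eval (herbrand v) \<sigma>) ts = map (inst \<sigma>) ts" by (simp add: eval_herbrand)
  then show ?thesis by (simp only: holds.simps) (simp add: herbrand_def)
qed

text \<open>For quantifier-free \<open>A\<close>, the literals in the negation normal form of the
  instance of \<open>A\<close>, or of its negation if \<open>b\<close> is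
  \<open>False\<close>.\<close>

fun lits :: "(nat \<Rightarrow> 'f sk tm) \<Rightarrow> bool \<Rightarrow> ('f, 'p) fm \<Rightarrow> (('p \<times> 'f sk tm list) \<times> bool) set" where
  "lits \<sigma> b (Atom p ts) = {((p, map (inst \<sigma>) ts), b)}"
| "lits \<sigma> b (Neg A) = lits \<sigma> (\<not> b) A"
| "lits \<sigma> b (Conj A B) = lits \<sigma> b A \<union> lits \<sigma> b B"
| "lits \<sigma> b (Disj A B) = lits \<sigma> b A \<union> lits \<sigma> b B"
| "lits \<sigma> b A = {}"

lemma finite_lits: "finite (lits \<sigma> b A)"
  by (induction A arbitrary: b) auto

lemma lits_preds: "((p, ts), s) \<in> lits \<sigma> b A \<Longrightarrow> ((p, length ts), s) \<in> preds_pol b A"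
  by (induction A arbitrary: b) auto

lemma lits_terms:
  "((p, us), s) \<in> lits \<sigma> b A \<Longrightarrow> u \<in> set us \<Longrightarrow> quantifier_free A \<Longrightarrow>
    \<exists>t. u = inst \<sigma> t \<and> fv_tm t \<subseteq> fv A \<and> funs_tm t \<subseteq> funs A"
proof (induction A arbitrary: b)
  case (Conj A B)
  then show ?case by simp blast
next
  case (Disj A B)
  then show ?case by simp blast
qed auto

text \<open>Passing under a negation flips both the polarity and the truth value, hence the single
  parameter \<open>b\<close> for the two.\<close>

lemma holds_lits:
  assumes "quantifier_free A" "\<And>a s. (a, s) \<in> lits \<sigma> b A \<Longrightarrow> v a = s \<Longrightarrow> w a = s"
    "holds (herbrand v) \<sigma> A = b"
  shows "holds (herbrand w) \<sigma> A = b"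
  using assms
proof (induction A arbitrary: b)
  case (Atom p ts)
  then show ?case unfolding holds_herbrand_Atom by simp
next
  case (Neg A)
  then show ?case using Neg.IH[of "\<not> b"] by auto
next
  case (Conj A B)
  then show ?case using Conj.IH[of b] by (cases b) auto
next
  case (Disj A B)
  then show ?case using Disj.IH[of b] by (cases b) auto
qed auto

lemma lit_mono_holds:
  assumes "quantifier_free A"
  shows "lit_mono (lits \<sigma> True A) (\<lambda>v. holds (herbrand v) \<sigma> A)"
  unfolding lit_mono_def
proof (intro allI impI)
  fix v w assume *: "preserves (lits \<sigma> True A) v w" and "holds (herbrand v) \<sigma> A"
  have "w a = s" if "(a, s) \<in> lits \<sigma> True A" "v a = s" for a s
    using *[unfolded preserves_def, THEN bspec, OF that(1)] that(2) by simp
  from holds_lits[OF assms this] show "holds (herbrand w) \<sigma> A"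
    using \<open>holds (herbrand v) \<sigma> A\<close> by simp
qed

text \<open>Valuations that agree on the atoms of \<open>L\<close> preserve its literals in both
  directions. For finite \<open>L\<close> this supplies the finiteness condition of
  compactness.\<close>

lemma lit_mono_determined:
  fixes L :: "('a \<times> bool) set"
  assumes L: "lit_mono L \<phi>"
  shows "determined_by (fst ` L) \<phi>"
  unfolding determined_by_def
proof (intro allI impI)
  fix v w :: "'a \<Rightarrow> bool"
  assume "\<forall>a\<in>fst ` L. v a = w a"
  then have eq: "v a = w a" if "(a, s) \<in> L" for a s using that by force
  have "\<phi> w" if "\<phi> v" by (rule lit_monoD[OF L that]) (metis eq)
  moreover have "\<phi> v" if "\<phi> w" by (rule lit_monoD[OF L that]) (metis eq)
  ultimately show "\<phi> v = \<phi> w" by blast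
qed

lemma lit_mono_UN:
  assumes "\<And>x. x \<in> X \<Longrightarrow> lit_mono (L x) (\<phi> x)"
  shows "lit_mono (\<Union>x\<in>X. L x) (\<lambda>v. \<forall>x\<in>X. \<phi> x v)"
    and "lit_mono (\<Union>x\<in>X. L x) (\<lambda>v. \<exists>x\<in>X. \<phi> x v)"
proof -
  have "\<phi> x w" if "preserves (\<Union>x\<in>X. L x) v w" "x \<in> X" "\<phi> x v" for v w x
  proof -
    have "preserves (L x) v w" using that(1,2) unfolding preserves_def by blast
    then show ?thesis using assms[OF that(2)] that(3) unfolding lit_mono_def by blast
  qed
  then show "lit_mono (\<Union>x\<in>X. L x) (\<lambda>v. \<forall>x\<in>X. \<phi> x v)"
    and "lit_mono (\<Union>x\<in>X. L x) (\<lambda>v. \<exists>x\<in>X. \<phi> x v)"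
    unfolding lit_mono_def by blast+
qed

section \<open>Closure of Horn formulas under intersection of valuations\<close>

lemma clause_negative_inter:
  assumes "clause A" "num_positive A = 0" "holds (herbrand v) \<sigma> A" "\<And>a. w a \<Longrightarrow> v a"
  shows "holds (herbrand w) \<sigma> A"
  using assms
proof (induction A)
  case (Neg A)
  then show ?case
    by (cases A) (auto simp: holds_herbrand_Atom simp del: holds.simps(3))
qed auto

text \<open>In a disjunction with at most one positive literal, one side is purely negative. If it
  is true at some \<open>v\<close> in \<open>V\<close>, it remains true at the smaller intersection.
  Otherwise the other side is true at all of \<open>V\<close>, and induction applies.\<close>

lemma clause_horn_inter:
  assumes "clause A" "num_positive A \<le> 1" "V \<noteq> {}" "\<And>v. v \<in> V \<Longrightarrow> holds (herbrand v) \<sigma> A"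
  shows "holds (herbrand (\<lambda>a. \<forall>v\<in>V. v a)) \<sigma> A"
  using assms
proof (induction A)
  case (Atom p ts)
  show ?case unfolding holds_herbrand_Atom
  proof
    fix v assume "v \<in> V"
    from Atom.prems(4)[OF this] show "v (p, map (inst \<sigma>) ts)" unfolding holds_herbrand_Atom .
  qed
next
  case (Neg A)
  from Neg.prems(3) obtain v where v: "v \<in> V" by blast
  show ?case
    by (rule clause_negative_inter[OF Neg.prems(1) _ Neg.prems(4)[OF v]]) (simp, erule bspec, rule v)
next
  case (Disj A B)
  let ?w = "\<lambda>a. \<forall>v\<in>V. v a"
  have neg: "holds (herbrand ?w) \<sigma> C"
    if "clause C" "num_positive C = 0" "v \<in> V" "holds (herbrand v) \<sigma> C" for C v
    by (rule clause_negative_inter[OF that(1,2,4)]) (erule bspec, rule that(3))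
  have *: "clause A" "clause B" using Disj.prems(1) by simp_all
  have AB: "holds (herbrand v) \<sigma> A \<or> holds (herbrand v) \<sigma> B" if "v \<in> V" for v
    using Disj.prems(4)[OF that] by simp
  consider "num_positive A = 0" "num_positive B \<le> 1" | "num_positive B = 0" "num_positive A \<le> 1"
    using Disj.prems(2) by fastforce
  then show ?case
  proof cases
    case 1
    have "holds (herbrand ?w) \<sigma> B" if "\<not> holds (herbrand ?w) \<sigma> A"
      by (rule Disj.IH(2)[OF *(2) 1(2) Disj.prems(3)]) (use AB neg[OF *(1) 1(1)] that in blast)
    then show ?thesis by (simp only: holds.simps) blast
  next
    case 2
    have "holds (herbrand ?w) \<sigma> A" if "\<not> holds (herbrand ?w) \<sigma> B"
      by (rule Disj.IH(1)[OF *(1) 2(2) Disj.prems(3)]) (use AB neg[OF *(2) 2(1)] that in blast)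
    then show ?thesis by (simp only: holds.simps) blast
  qed
qed auto

lemma horn_matrix_inter:
  assumes "horn_matrix A" "V \<noteq> {}" "\<And>v. v \<in> V \<Longrightarrow> holds (herbrand v) \<sigma> A"
  shows "holds (herbrand (\<lambda>a. \<forall>v\<in>V. v a)) \<sigma> A"
  using assms
proof (induction A)
  case (Atom p ts)
  show ?case
    by (rule clause_horn_inter[OF _ _ Atom.prems(2,3)]) (use Atom.prems(1) in simp_all)
next
  case (Neg A)
  show ?case
    by (rule clause_horn_inter[OF _ _ Neg.prems(2,3)]) (use Neg.prems(1) in simp_all)
next
  case (Disj A B)
  show ?case
    by (rule clause_horn_inter[OF _ _ Disj.prems(2,3)]) (use Disj.prems(1) in simp_all)
qed auto

section \<open>Lifting\<close>

text \<open>
  The value of an expanded term in an interpretation \<open>I\<close> with Skolem functions \<open>S\<close>. Terms in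
  \<open>opp\<close>, which belong to the other side, act as additional constants with values given by \<open>\<theta>\<close>.
\<close>

fun val :: "('f sk tm \<Rightarrow> bool) \<Rightarrow> ('u, 'f, 'p) interp \<Rightarrow> (nat \<Rightarrow> 'u list \<Rightarrow> 'u) \<Rightarrow>
    ('f sk tm \<Rightarrow> 'u) \<Rightarrow> 'f sk tm \<Rightarrow> 'u" where
  "val opp I S \<theta> (Var x) = \<theta> (Var x)"
| "val opp I S \<theta> (App g ts) = (if opp (App g ts) then \<theta> (App g ts) else
    (case g of Inl f \<Rightarrow> Fun I f (map (val opp I S \<theta>) ts)
     | Inr (s, i) \<Rightarrow> S i (map (val opp I S \<theta>) ts)))"

lemma val_opp: "opp t \<Longrightarrow> val opp I S \<theta> t = \<theta> t"
  by (cases t) auto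

lemma val_dom:
  assumes "interpretation_ok I" "\<And>i us. S i us \<in> Dom I" "range \<theta> \<subseteq> Dom I"
  shows "val opp I S \<theta> t \<in> Dom I"
proof (induction t)
  case (Var x)
  then show ?case using assms(3) by auto
next
  case (App g ts)
  then have "map (val opp I S \<theta>) ts \<in> lists (Dom I)" by auto
  then show ?case
    using assms by (auto simp: interpretation_ok_def image_subset_iff split: sum.split prod.split)
qed

text \<open>Computing the value of \<open>t\<close> consults \<open>\<theta>\<close> only at
  subterms of \<open>t\<close>. By its size \<open>s\<close> is no proper subterm of
  \<open>t\<close>, and it differs from \<open>t\<close> itself.\<close>

lemma val_upd:
  assumes "size t \<le> size s" "t \<noteq> s"
  shows "val opp I S (\<theta>(s := u)) t = val opp I S \<theta> t"
  using assms
proof (induction t)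
  case (App g ts)
  have "val opp I S (\<theta>(s := u)) t = val opp I S \<theta> t" if "t \<in> set ts" for t
  proof (rule App.IH[OF that])
    have "size t < size (App g ts)" using size_list_estimation'[OF that, of "size t" size] by simp
    then show "size t \<le> size s" "t \<noteq> s" using App.prems(1) by auto
  qed
  then have "map (val opp I S (\<theta>(s := u))) ts = map (val opp I S \<theta>) ts" by simp
  then show ?case using App.prems(2) by (simp only: val.simps fun_upd_other not_False_eq_True)
qed simp

lemma val_inst:
  assumes "\<And>f ts. (f, length ts) \<in> A \<Longrightarrow> \<not> opp (App (Inl f) ts)" "funs_tm t \<subseteq> A"
  shows "val opp I S \<theta> (inst \<sigma> t) = eval I (val opp I S \<theta> \<circ> \<sigma>) t"
  using assms(2)
proof (induction t)
  case (App f ts)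
  have "map (val opp I S \<theta>) (map (inst \<sigma>) ts) = map (eval I (val opp I S \<theta> \<circ> \<sigma>)) ts"
    using App by (auto simp: SUP_le_iff comp_def)
  moreover have "\<not> opp (App (Inl f) (map (inst \<sigma>) ts))" using App.prems by (intro assms(1)) simp
  ultimately show ?case by (simp only: inst.simps val.simps eval.simps if_False sum.case)
qed simp

text \<open>Turns an interpretation into a propositional valuation of atoms over terms. This carries
  the propositional interpolant over to arbitrary interpretations.\<close>

definition term_val :: "('u, 'f, 'p) interp \<Rightarrow> ('t \<Rightarrow> 'u) \<Rightarrow> 'p \<times> 't list \<Rightarrow> bool" where
  "term_val I h = (\<lambda>(p, ts). Rel I p (map h ts))"

lemma holds_term_val:
  assumes opp: "\<And>f ts. (f, length ts) \<in> funs M \<Longrightarrow> \<not> opp (App (Inl f) ts)"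
    and "quantifier_free M"
  shows "holds (herbrand (term_val I (val opp I S \<theta>))) \<sigma> M \<longleftrightarrow> holds I (val opp I S \<theta> \<circ> \<sigma>) M"
proof -
  have "holds (herbrand (term_val I (val opp I S \<theta>))) \<sigma> B \<longleftrightarrow> holds I (val opp I S \<theta> \<circ> \<sigma>) B"
    if "quantifier_free B" "funs B \<subseteq> funs M" for B
    using that
  proof (induction B)
    case (Atom p ts)
    have "val opp I S \<theta> (inst \<sigma> t) = eval I (val opp I S \<theta> \<circ> \<sigma>) t" if "t \<in> set ts" for t
      using Atom.prems that by (intro val_inst[of "funs M"] opp) auto
    then have "map (val opp I S \<theta>) (map (inst \<sigma>) ts) = map (eval I (val opp I S \<theta> \<circ> \<sigma>)) ts"
      by simp
    then show ?case
      unfolding holds_herbrand_Atom by (simp only: term_val_def prod.case holds.simps)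
  qed auto
  then show ?thesis using assms(2) by blast
qed

text \<open>No symbol of \<open>M\<close> and no Skolem function of \<open>P\<close> heads an
  \<open>opp\<close> term, so \<open>val\<close> maps a \<open>skolem_list\<close> to values that
  obey \<open>S\<close>. One \<open>S\<close> serves all \<open>\<theta>\<close>, so the values of
  \<open>opp\<close> terms can be chosen afterwards.\<close>

lemma skolem_instances:
  fixes I :: "('u, 'f, 'p) interp"
  assumes I: "interpretation_ok I"
    and M: "quantified (Dom I) P (\<lambda>us. holds I ((!) us) M) []" "quantifier_free M"
      "fv M \<subseteq> {..<length P}"
    and opp: "\<forall>f ts. (f, length ts) \<in> funs M \<longrightarrow> \<not> opp (App (Inl f) ts)"
      "\<forall>i ts. i < length P \<longrightarrow> \<not> P ! i \<longrightarrow> \<not> opp (App (Inr (s, i)) ts)"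
  shows "\<exists>S. (\<forall>i us. S i us \<in> Dom I) \<and>
    (\<forall>\<theta> ts. range \<theta> \<subseteq> Dom I \<longrightarrow> skolem_list s P ts \<longrightarrow>
      holds (herbrand (term_val I (val opp I S \<theta>))) ((!) ts) M)"
proof -
  have "Dom I \<noteq> {}" using I by (simp add: interpretation_ok_def)
  from quantified_skolem[OF this M(1)] obtain S where S: "\<And>i us. S i us \<in> Dom I"
    and holds: "\<And>us. length us = length P \<Longrightarrow> set us \<subseteq> Dom I \<Longrightarrow>
      (\<And>i. i < length P \<Longrightarrow> \<not> P ! i \<Longrightarrow> us ! i = S i (take i us)) \<Longrightarrow> holds I ((!) us) M"
    by blast
  show ?thesis
  proof (intro exI[of _ S] conjI allI impI S)
    fix \<theta> :: "'f sk tm \<Rightarrow> 'u" and ts :: "'f sk tm list"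
    assume \<theta>: "range \<theta> \<subseteq> Dom I" and ts: "skolem_list s P ts"
    let ?v = "val opp I S \<theta>"
    have len: "length ts = length P" using ts by (simp add: skolem_list_def)
    have "holds I ((!) (map ?v ts)) M"
    proof (rule holds)
      show "set (map ?v ts) \<subseteq> Dom I" using val_dom[OF I S \<theta>] by auto
      show "map ?v ts ! i = S i (take i (map ?v ts))" if "i < length P" "\<not> P ! i" for i
      proof -
        have "ts ! i = App (Inr (s, i)) (take i ts)" using ts that by (simp add: skolem_list_def)
        then show ?thesis using opp(2) that len by (simp add: take_map)
      qed
    qed (simp add: len)
    also have "holds I ((!) (map ?v ts)) M \<longleftrightarrow> holds I (?v \<circ> (!) ts) M"
      by (rule holds_cong) (use M(3) len in auto)
    finally show "holds (herbrand (term_val I ?v)) ((!) ts) M"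
      using holds_term_val[of M opp] opp(1) M(2) by blast
  qed
qed

section \<open>Abstraction of terms by variables, and quantification of these variables\<close>

definition shared :: "('f \<times> nat) set \<Rightarrow> 'f sk tm \<Rightarrow> bool" where
  "shared A t \<longleftrightarrow> (\<exists>f ts. t = App (Inl f) ts \<and> (f, length ts) \<in> A)"

lemma shared_simps [simp]:
  "\<not> shared A (Var x)"
  "shared A (App (Inl f) ts) \<longleftrightarrow> (f, length ts) \<in> A"
  "\<not> shared A (App (Inr q) ts)"
  by (auto simp: shared_def)

text \<open>\<open>projl\<close> meets only heads of the form \<open>Inl f\<close>, since Skolem
  terms are never \<open>shared\<close>. The terms that give way to variables are those collected by
  \<open>foreign\<close>.\<close>

fun lift :: "('f \<times> nat) set \<Rightarrow> ('f sk tm \<Rightarrow> nat) \<Rightarrow> 'f sk tm \<Rightarrow> 'f tm" where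
  "lift A ix (Var x) = Var (ix (Var x))"
| "lift A ix (App g ts) =
    (if shared A (App g ts) then App (projl g) (map (lift A ix) ts) else Var (ix (App g ts)))"

fun foreign :: "('f \<times> nat) set \<Rightarrow> 'f sk tm \<Rightarrow> 'f sk tm set" where
  "foreign A (Var x) = {Var x}"
| "foreign A (App g ts) = (if shared A (App g ts) then \<Union>t\<in>set ts. foreign A t else {App g ts})"

lemma finite_foreign: "finite (foreign A t)"
  by (induction t) auto

lemma foreign_not_shared: "s \<in> foreign A t \<Longrightarrow> \<not> shared A s"
  by (induction t) (auto split: if_splits)

lemma fv_lift: "fv_tm (lift A ix t) = ix ` foreign A t"
  by (induction t) auto

lemma funs_lift: "funs_tm (lift A ix t) \<subseteq> A"
proof (induction t)
  case (App g ts)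
  then show ?case by (cases g) auto
qed simp

lemma foreign_inst: "funs_tm t \<subseteq> A \<Longrightarrow> fv_tm t = {} \<Longrightarrow> foreign A (inst \<sigma> t) = {}"
  by (induction t) (auto simp: SUP_le_iff)

lemma eval_lift:
  assumes "\<And>s. shared A s \<Longrightarrow> \<not> opp s" "\<And>s. s \<in> foreign A t \<Longrightarrow> e (ix s) = val opp I S \<theta> s"
  shows "eval I e (lift A ix t) = val opp I S \<theta> t"
  using assms(2)
proof (induction t)
  case (App g ts)
  show ?case
  proof (cases "shared A (App g ts)")
    case True
    then obtain f where f: "g = Inl f" by (auto simp: shared_def)
    have "eval I e (lift A ix t) = val opp I S \<theta> t" if "t \<in> set ts" for t
      using True that by (intro App.IH App.prems) auto
    then have "map (eval I e) (map (lift A ix) ts) = map (val opp I S \<theta>) ts" by simp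
    moreover have "\<not> opp (App (Inl f) ts)" using assms(1) True f by simp
    ultimately show ?thesis using True
      by (simp only: f lift.simps val.simps eval.simps if_True if_False sum.case sum.sel)
  next
    case False
    then show ?thesis using App.prems[of "App g ts"] by simp
  qed
qed simp

fun close :: "('t \<Rightarrow> bool) \<Rightarrow> ('t \<Rightarrow> nat) \<Rightarrow> 't list \<Rightarrow> ('f, 'p) fm \<Rightarrow> ('f, 'p) fm" where
  "close ex ix [] A = A"
| "close ex ix (t # L) A =
    (if ex t then Exists (ix t) (close ex ix L A) else Forall (ix t) (close ex ix L A))"

lemma close_syntax:
  "fv (close ex ix L A) = fv A - ix ` set L"
  "funs (close ex ix L A) = funs A"
  "preds_pol b (close ex ix L A) = preds_pol b A"
  "horn_form (close ex ix L A) = horn_form A"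
  "\<forall>t. \<not> ex t \<Longrightarrow> universal_form (close ex ix L A) = universal_form A"
  "\<forall>t. ex t \<Longrightarrow> existential_form (close ex ix L A) = existential_form A"
  by (induction L) auto

text \<open>Dualizing the prefix lets \<open>holds_close\<close> serve both sides: applied to a
  negated matrix, it refutes the interpolant in a model of \<open>\<not> G\<close>.\<close>

lemma holds_close_Neg:
  "holds I e (close (\<lambda>t. \<not> ex t) ix L (Neg A)) \<longleftrightarrow> \<not> holds I e (close ex ix L A)"
  by (induction L arbitrary: e) auto

text \<open>
  Since the quantifiers are sorted by term size, the value of a term \<open>t\<close> with \<open>ex t\<close> depends only
  on values \<open>\<theta>\<close> chosen by earlier universal quantifiers, so it can serve as witness.
\<close>

lemma holds_close:
  assumes I: "interpretation_ok I" "\<And>i us. S i us \<in> Dom I"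
    and L: "sorted_wrt (\<lambda>s t. size s \<le> size t) L" "distinct L" "inj_on ix (set L)"
    and opp: "\<And>s. s \<in> set L \<Longrightarrow> opp s \<longleftrightarrow> \<not> ex s"
    and A: "\<And>\<theta> e. range \<theta> \<subseteq> Dom I \<Longrightarrow> (\<And>s. s \<in> set L \<Longrightarrow> e (ix s) = val opp I S \<theta> s) \<Longrightarrow> holds I e A"
  shows "holds I e (close ex ix L A)"
proof -
  \<comment> \<open>Invariant: the terms of \<open>L1\<close> have been quantified, and
    \<open>e\<close> assigns to their variables the values computed from \<open>\<theta>\<close>, in
    which the universal choices are recorded.\<close>
  have "holds I e (close ex ix L2 A)"
    if "L = L1 @ L2" "range \<theta> \<subseteq> Dom I" "\<And>s. s \<in> set L1 \<Longrightarrow> e (ix s) = val opp I S \<theta> s" for L1 L2 \<theta> e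
    using that
  proof (induction L2 arbitrary: L1 \<theta> e)
    case Nil
    then show ?case using A[of \<theta> e] by simp
  next
    case (Cons t L2)
    have sL: "s \<in> set L" if "s \<in> set L1 \<or> s = t" for s using Cons.prems(1) that by auto
    have ne: "s \<noteq> t" if "s \<in> set L1" for s using L(2) Cons.prems(1) that by auto
    have ix: "ix s \<noteq> ix t" if "s \<in> set L1" for s
      using inj_onD[OF L(3), of s t] sL ne[OF that] that by blast
    have size: "size s \<le> size t" if "s \<in> set L1" for s
      using L(1) Cons.prems(1) that by (auto simp: sorted_wrt_append)
    show ?case
    proof (cases "ex t")
      case True
      have "holds I (e(ix t := val opp I S \<theta> t)) (close ex ix L2 A)"
        by (rule Cons.IH[of "L1 @ [t]" \<theta>]) (use Cons.prems ix in auto)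
      then show ?thesis using True val_dom[OF I Cons.prems(2)] by auto
    next
      case False
      have "holds I (e(ix t := u)) (close ex ix L2 A)" if "u \<in> Dom I" for u
      \<comment> \<open>The universally chosen \<open>u\<close> becomes the value of
        \<open>t\<close>. Terms of \<open>L1\<close> are no larger than \<open>t\<close> and
        different from it, so their values do not change.\<close>
      proof (rule Cons.IH[of "L1 @ [t]" "\<theta>(t := u)"])
        show "range (\<theta>(t := u)) \<subseteq> Dom I" using Cons.prems(2) that by (auto simp: image_subset_iff)
        have "opp t" using opp sL False by blast
        then show "(e(ix t := u)) (ix s) = val opp I S (\<theta>(t := u)) s" if "s \<in> set (L1 @ [t])" for s
          using that Cons.prems(3) ix ne size by (auto simp: val_upd val_opp)
      qed (use Cons.prems in simp)
      then show ?thesis using False by auto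
    qed
  qed
  note main = this
  obtain d where "d \<in> Dom I" using I(1) by (auto simp: interpretation_ok_def)
  then show ?thesis by (intro main[of "[]" L "\<lambda>_. d"]) auto
qed

section \<open>Interpolation\<close>

definition clause_terms :: "('p \<times> 't list) horn_clause \<Rightarrow> 't set" where
  "clause_terms C = (\<Union>(a, s)\<in>clause_lits C. set (snd a))"

fun atom_fm :: "('t \<Rightarrow> 'f tm) \<Rightarrow> 'p \<times> 't list \<Rightarrow> ('f, 'p) fm" where
  "atom_fm g (p, ts) = Atom p (map g ts)"

definition clause_fm ::
    "('t \<Rightarrow> 'f tm) \<Rightarrow> ('p \<times> 't list) list \<Rightarrow> ('p \<times> 't list) option \<Rightarrow> ('f, 'p) fm" where
  "clause_fm g ns h = foldr Disj (map (\<lambda>a. Neg (atom_fm g a)) ns)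
    (case h of None \<Rightarrow> Falsity | Some a \<Rightarrow> atom_fm g a)"

lemma clause_fm_syntax:
  "quantifier_free (clause_fm g ns h)"
  "clause (clause_fm g ns h)" "num_positive (clause_fm g ns h) \<le> 1"
  "preds_pol True (clause_fm g ns h) =
    (\<lambda>(a, s). ((fst a, length (snd a)), s)) ` clause_lits (set ns, h)"
  "funs (clause_fm g ns h) = (\<Union>t\<in>clause_terms (set ns, h). funs_tm (g t))"
  "fv (clause_fm g ns h) = (\<Union>t\<in>clause_terms (set ns, h). fv_tm (g t))"
  by (induction ns)
    (auto simp: clause_fm_def clause_lits_def clause_terms_def split: option.splits)

lemma holds_atom_fm: "holds I e (atom_fm g a) \<longleftrightarrow> term_val I (\<lambda>t. eval I e (g t)) a"
  by (cases a) (simp add: term_val_def comp_def)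

lemma holds_clause_fm:
  "holds I e (clause_fm g ns h) \<longleftrightarrow> sat_clause (term_val I (\<lambda>t. eval I e (g t))) (set ns, h)"
  by (induction ns)
    (auto simp: clause_fm_def sat_clause_def holds_atom_fm split: option.splits)

text \<open>Clauses are added one by one to a conjunction that starts as \<open>Truth\<close>. With
  \<open>g\<close> a lifting of terms, this produces the matrix of the interpolant from the
  propositional one.\<close>

lemma horn_matrix_clauses:
  fixes g :: "'t \<Rightarrow> 'f tm" and \<C> :: "('p \<times> 't list) horn_clause set"
  assumes "finite \<C>" "\<forall>C\<in>\<C>. finite (fst C)"
  shows "\<exists>A :: ('f, 'p) fm. quantifier_free A \<and> horn_matrix A \<and>
    preds_pol True A = (\<lambda>(a, s). ((fst a, length (snd a)), s)) ` (\<Union>C\<in>\<C>. clause_lits C) \<and>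
    funs A = (\<Union>C\<in>\<C>. \<Union>t\<in>clause_terms C. funs_tm (g t)) \<and>
    fv A = (\<Union>C\<in>\<C>. \<Union>t\<in>clause_terms C. fv_tm (g t)) \<and>
    (\<forall>(I :: ('u, 'f, 'p) interp) e.
      holds I e A \<longleftrightarrow> (\<forall>C\<in>\<C>. sat_clause (term_val I (\<lambda>t. eval I e (g t))) C))"
  using assms
proof (induction \<C> rule: finite_induct)
    case empty
    show ?case by (rule exI[of _ Truth]) simp
  next
    case (insert C \<C>)
    then obtain A :: "('f, 'p) fm" where A: "quantifier_free A" "horn_matrix A"
      "preds_pol True A = (\<lambda>(a, s). ((fst a, length (snd a)), s)) ` (\<Union>C\<in>\<C>. clause_lits C)"
      "funs A = (\<Union>C\<in>\<C>. \<Union>t\<in>clause_terms C. funs_tm (g t))"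
      "fv A = (\<Union>C\<in>\<C>. \<Union>t\<in>clause_terms C. fv_tm (g t))"
      "\<forall>(I :: ('u, 'f, 'p) interp) e.
        holds I e A \<longleftrightarrow> (\<forall>C\<in>\<C>. sat_clause (term_val I (\<lambda>t. eval I e (g t))) C)"
      by auto
    obtain ns h where C: "C = (set ns, h)"
      using finite_list[of "fst C"] insert.prems by (metis insertI1 prod.collapse)
    show ?case
      using A horn_matrix_clause[OF clause_fm_syntax(2,3)]
      by (intro exI[of _ "Conj (clause_fm g ns h) A"])
        (simp add: C clause_fm_syntax holds_clause_fm image_Un)
qed

lemma sat_clause_cong:
  assumes "\<And>a s. (a, s) \<in> clause_lits C \<Longrightarrow> v a = w a"
  shows "sat_clause v C \<longleftrightarrow> sat_clause w C"
proof -
  have "v a = w a" if "a \<in> fst C \<union> set_option (snd C)" for a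
    using assms[of a False] assms[of a True] that by (auto simp: clause_lits_def)
  then show ?thesis unfolding sat_clause_def by (metis UnCI)
qed

lemma sat_clause_term_val_cong:
  assumes "\<And>t. t \<in> clause_terms C \<Longrightarrow> h t = k t"
  shows "sat_clause (term_val I h) C \<longleftrightarrow> sat_clause (term_val I k) C"
proof (rule sat_clause_cong)
  fix a s assume "(a, s) \<in> clause_lits C"
  then have "map h (snd a) = map k (snd a)"
    by (intro map_cong refl assms) (auto simp: clause_terms_def)
  then show "term_val I h a = term_val I k a" by (simp only: term_val_def case_prod_beta)
qed

lemma sorted_by_size:
  assumes "finite T"
  obtains L where "set L = T" "distinct L" "sorted_wrt (\<lambda>s t. size s \<le> size t) L"
proof -
  from finite_distinct_list[OF assms] obtain L where L: "set L = T" "distinct L" by blast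
  have "sorted (map size (sort_key size L))" by (rule sorted_sort_key)
  then show thesis using L by (intro that[of "sort_key size L"]) (simp_all add: sorted_map)
qed

section \<open>Herbrand's theorem and interpolation of prenex formulas\<close>

lemma quantified_Neg:
  "quantified D (map Not P) (\<lambda>us. holds I ((!) us) (Neg A)) us \<longleftrightarrow>
    \<not> quantified D P (\<lambda>us. holds I ((!) us) A) us"
  by (simp add: quantified_not)

text \<open>A valuation that makes all Skolemized instances of \<open>M\<close> true and all those
  of \<open>N\<close> false would give a Herbrand interpretation contradicting the entailment.
  Compactness leaves finitely many instances.\<close>

lemma herbrand_instances:
  fixes M N :: "('f, 'p) fm"
  assumes "quantifier_free M" "quantifier_free N"
    and entails: "\<forall>I :: ('f sk tm, 'f, 'p) interp. interpretation_ok I \<longrightarrow>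
      quantified (Dom I) P (\<lambda>us. holds I ((!) us) M) [] \<longrightarrow>
      quantified (Dom I) Q (\<lambda>us. holds I ((!) us) N) []"
  shows "\<exists>X Y. finite X \<and> finite Y \<and> (\<forall>ts\<in>X. skolem_list True P ts) \<and>
    (\<forall>ts\<in>Y. skolem_list False (map Not Q) ts) \<and>
    (\<forall>v. (\<forall>ts\<in>X. holds (herbrand v) ((!) ts) M) \<longrightarrow> (\<exists>ts\<in>Y. holds (herbrand v) ((!) ts) N))"
proof -
  \<comment> \<open>The tag \<open>True\<close> marks instances of \<open>M\<close>, required to
    hold, and \<open>False\<close> instances of \<open>N\<close>, required to fail.\<close>
  define Z where "Z = Pair True ` {ts :: 'f sk tm list. skolem_list True P ts} \<union>
    Pair False ` {ts. skolem_list False (map Not Q) ts}"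
  define \<phi> :: "bool \<times> 'f sk tm list \<Rightarrow> ('p \<times> 'f sk tm list \<Rightarrow> bool) \<Rightarrow> bool"
    where "\<phi> = (\<lambda>(b, ts) v. if b then holds (herbrand v) ((!) ts) M
                               else \<not> holds (herbrand v) ((!) ts) N)"
  have det: "\<exists>S. finite S \<and> determined_by S (\<lambda>v. holds (herbrand v) ((!) ts) A)"
    if "quantifier_free A" for A :: "('f, 'p) fm" and ts
    using lit_mono_determined[OF lit_mono_holds[OF that]] finite_imageI[OF finite_lits] by blast
  have "\<forall>i\<in>Z. \<exists>S. finite S \<and> determined_by S (\<phi> i)"
  proof
    fix i show "\<exists>S. finite S \<and> determined_by S (\<phi> i)"
    proof (cases i)
      case (Pair b ts)
      show ?thesis using det[OF assms(1), of ts] det[OF assms(2), of ts]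
        by (cases b) (simp_all add: Pair \<phi>_def determined_by_def)
    qed
  qed
  moreover have "\<forall>v. \<exists>i\<in>Z. \<not> \<phi> i v"
  proof (rule allI, rule ccontr)
    fix v
    assume "\<not> (\<exists>i\<in>Z. \<not> \<phi> i v)"
    then have *: "\<phi> i v" if "i \<in> Z" for i using that by blast
    have "holds (herbrand v) ((!) ts) M" if "skolem_list True P ts" for ts
      using *[of "(True, ts)"] that by (simp add: Z_def \<phi>_def)
    from quantified_herbrand[OF this]
    have "quantified (Dom (herbrand v)) P (\<lambda>us. holds (herbrand v) ((!) us) M) []"
      by (simp add: herbrand_def)
    moreover have "holds (herbrand v) ((!) ts) (Neg N)" if "skolem_list False (map Not Q) ts" for ts
      using *[of "(False, ts)"] that by (auto simp add: Z_def \<phi>_def)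
    from quantified_herbrand[OF this]
    have "quantified (Dom (herbrand v)) (map Not Q) (\<lambda>us. holds (herbrand v) ((!) us) (Neg N)) []"
      by (simp add: herbrand_def)
    ultimately show False using entails[THEN spec, THEN mp, OF herbrand_ok] unfolding quantified_Neg by blast
  qed
  ultimately have "\<exists>W. finite W \<and> W \<subseteq> Z \<and> (\<forall>v. \<exists>i\<in>W. \<not> \<phi> i v)"
    by (rule propositional_compactness)
  then obtain W where W: "finite W" "W \<subseteq> Z" "\<forall>v. \<exists>i\<in>W. \<not> \<phi> i v" by (elim exE conjE)
  let ?X = "\<lambda>b. snd ` {i \<in> W. fst i = b}"
  have "\<forall>v. (\<forall>ts\<in>?X True. holds (herbrand v) ((!) ts) M) \<longrightarrow>
      (\<exists>ts\<in>?X False. holds (herbrand v) ((!) ts) N)"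
  proof (intro allI impI)
    fix v assume "\<forall>ts\<in>?X True. holds (herbrand v) ((!) ts) M"
    moreover obtain b ts where "(b, ts) \<in> W" "\<not> \<phi> (b, ts) v" using spec[OF W(3), of v] by auto
    ultimately show "\<exists>ts\<in>?X False. holds (herbrand v) ((!) ts) N"
      by (cases b) (force simp: \<phi>_def)+
  qed
  moreover have "\<forall>ts\<in>?X True. skolem_list True P ts"
      "\<forall>ts\<in>?X False. skolem_list False (map Not Q) ts"
    using W(2) by (auto simp: Z_def)
  moreover have "finite (?X b)" for b using W(1) by simp
  ultimately show ?thesis by (intro exI[of _ "?X True"] exI[of _ "?X False"] conjI)
qed

text \<open>\<open>ex\<close> decides which abstracted terms are quantified existentially. It is
  prescribed only for symbols and Skolem functions belonging to one side; the freedom elsewhere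
  permits a constant \<open>ex\<close>, which makes the prefix purely universal or purely
  existential. The clause for \<open>P = []\<close> covers the case in which both (2) and (3)
  apply.\<close>

lemma prenex_interpolation:
  fixes M N :: "('f, 'p) fm" and ex :: "'f sk tm \<Rightarrow> bool"
  assumes qf: "quantifier_free M" "quantifier_free N" and horn: "horn_matrix M"
    and fv: "fv M \<subseteq> {..<length P}" "fv N \<subseteq> {..<length Q}"
    and entails: "\<forall>I :: ('f sk tm, 'f, 'p) interp. interpretation_ok I \<longrightarrow>
      quantified (Dom I) P (\<lambda>us. holds I ((!) us) M) [] \<longrightarrow>
      quantified (Dom I) Q (\<lambda>us. holds I ((!) us) N) []"
    and ex: "\<forall>f ts. (f, length ts) \<in> funs M - funs N \<longrightarrow> ex (App (Inl f) ts)"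
      "\<forall>i ts. i < length P \<longrightarrow> \<not> P ! i \<longrightarrow> ex (App (Inr (True, i)) ts)"
      "\<forall>f ts. (f, length ts) \<in> funs N - funs M \<longrightarrow> \<not> ex (App (Inl f) ts)"
      "\<forall>i ts. i < length Q \<longrightarrow> Q ! i \<longrightarrow> \<not> ex (App (Inr (False, i)) ts)"
  shows "\<exists>H. fv H = {} \<and> preds_pol True H \<subseteq> preds_pol True M \<inter> preds_pol True N \<and>
    funs H \<subseteq> funs M \<inter> funs N \<and> horn_form H \<and>
    ((\<forall>t. \<not> ex t) \<longrightarrow> universal_form H) \<and> ((\<forall>t. ex t) \<longrightarrow> existential_form H) \<and>
    (P = [] \<longrightarrow> funs M \<subseteq> funs N \<longrightarrow> quantifier_free H) \<and>
    (\<forall>(I :: ('u, 'f, 'p) interp) e. interpretation_ok I \<longrightarrow>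
      quantified (Dom I) P (\<lambda>us. holds I ((!) us) M) [] \<longrightarrow> holds I e H) \<and>
    (\<forall>(I :: ('u, 'f, 'p) interp) e. interpretation_ok I \<longrightarrow> holds I e H \<longrightarrow>
      quantified (Dom I) Q (\<lambda>us. holds I ((!) us) N) [])"
proof -
  from herbrand_instances[OF qf entails] obtain X Y where XY: "finite X" "finite Y"
    "\<forall>ts\<in>X. skolem_list True P ts" "\<forall>ts\<in>Y. skolem_list False (map Not Q) ts"
    "\<forall>v. (\<forall>ts\<in>X. holds (herbrand v) ((!) ts) M) \<longrightarrow> (\<exists>ts\<in>Y. holds (herbrand v) ((!) ts) N)"
    by (elim exE conjE)
  define LM where "LM = (\<Union>ts\<in>X. lits ((!) ts) True M)"
  define LN where "LN = (\<Union>ts\<in>Y. lits ((!) ts) True N)"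
  have finLM: "finite LM" unfolding LM_def using XY(1) finite_lits by blast
  have inter: "\<forall>V. V \<noteq> {} \<longrightarrow> (\<forall>v\<in>V. \<forall>ts\<in>X. holds (herbrand v) ((!) ts) M) \<longrightarrow>
      (\<forall>ts\<in>X. holds (herbrand (\<lambda>a. \<forall>v\<in>V. v a)) ((!) ts) M)"
  proof (intro allI impI ballI)
    fix V ts assume V: "V \<noteq> {}" "\<forall>v\<in>V. \<forall>ts\<in>X. holds (herbrand v) ((!) ts) M" and ts: "ts \<in> X"
    show "holds (herbrand (\<lambda>a. \<forall>v\<in>V. v a)) ((!) ts) M"
      by (rule horn_matrix_inter[OF horn V(1)]) (use V(2) ts in simp)
  qed
  have "lit_mono LM (\<lambda>v. \<forall>ts\<in>X. holds (herbrand v) ((!) ts) M)"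
    "lit_mono LN (\<lambda>v. \<exists>ts\<in>Y. holds (herbrand v) ((!) ts) N)"
    unfolding LM_def LN_def by (intro lit_mono_UN lit_mono_holds qf)+
  from propositional_horn_interpolation[OF this finLM inter XY(5)]
  obtain \<C> where \<C>: "finite \<C>"
    "\<forall>C\<in>\<C>. clause_lits C \<subseteq> LM \<inter> LN \<and>
      (\<forall>v. (\<forall>ts\<in>X. holds (herbrand v) ((!) ts) M) \<longrightarrow> sat_clause v C)"
    "\<forall>v. (\<forall>C\<in>\<C>. sat_clause v C) \<longrightarrow> (\<exists>ts\<in>Y. holds (herbrand v) ((!) ts) N)"
    by (elim exE conjE)
  have \<C>_lits: "clause_lits C \<subseteq> LM \<inter> LN" if "C \<in> \<C>" for C using \<C>(2) that by blast
  define A where "A = funs M \<inter> funs N"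
  define T where "T = (\<Union>C\<in>\<C>. \<Union>t\<in>clause_terms C. foreign A t)"
  have fin_lits: "finite (clause_lits C)" if "C \<in> \<C>" for C
    using finite_subset[OF \<C>_lits[OF that]] finLM by blast
  have "finite (clause_terms C)" if "C \<in> \<C>" for C
    using fin_lits[OF that] unfolding clause_terms_def by auto
  then have "finite T" unfolding T_def using \<C>(1) finite_foreign by blast
  from sorted_by_size[OF this] obtain L
    where L: "set L = T" "distinct L" "sorted_wrt (\<lambda>s t. size s \<le> size t) L" by blast
  from finite_imp_inj_to_nat_seg[OF \<open>finite T\<close>] obtain ix :: "'f sk tm \<Rightarrow> nat"
    where ix: "inj_on ix (set L)" unfolding L(1) by blast
  have "\<forall>C\<in>\<C>. finite (fst C)"
  proof
    fix C assume "C \<in> \<C>"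
    have "fst C \<subseteq> fst ` clause_lits C" by (force simp: clause_lits_def)
    then show "finite (fst C)" by (rule finite_subset) (use fin_lits[OF \<open>C \<in> \<C>\<close>] in simp)
  qed
  from horn_matrix_clauses[OF \<C>(1) this, where g = "lift A ix"]
  obtain B :: "('f, 'p) fm" where B: "quantifier_free B" "horn_matrix B"
    "preds_pol True B = (\<lambda>(a, s). ((fst a, length (snd a)), s)) ` (\<Union>C\<in>\<C>. clause_lits C)"
    "funs B = (\<Union>C\<in>\<C>. \<Union>t\<in>clause_terms C. funs_tm (lift A ix t))"
    "fv B = (\<Union>C\<in>\<C>. \<Union>t\<in>clause_terms C. fv_tm (lift A ix t))"
    and B_holds: "\<forall>(I :: ('u, 'f, 'p) interp) e.
      holds I e B \<longleftrightarrow> (\<forall>C\<in>\<C>. sat_clause (term_val I (\<lambda>t. eval I e (lift A ix t))) C)"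
    by (elim exE conjE)
  have T: "\<not> shared A t" if "t \<in> set L" for t
    using that foreign_not_shared unfolding L(1) T_def by blast
  \<comment> \<open>Once each variable has the value of the term it replaces, the lifted matrix is
    true iff the propositional clauses are true at the valuation induced by
    \<open>val\<close>.\<close>
  have B_val: "holds I e B \<longleftrightarrow> (\<forall>C\<in>\<C>. sat_clause (term_val I (val opp I S \<theta>)) C)"
    if "\<And>s. shared A s \<Longrightarrow> \<not> opp s" "\<And>s. s \<in> set L \<Longrightarrow> e (ix s) = val opp I S \<theta> s"
    for I :: "('u, 'f, 'p) interp" and e opp S \<theta>
    unfolding B_holds[rule_format]
  proof (intro ball_cong refl sat_clause_term_val_cong eval_lift that)
    show "s \<in> set L" if "C \<in> \<C>" "t \<in> clause_terms C" "s \<in> foreign A t" for C t s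
      using that unfolding L(1) T_def by blast
  qed
  define H where "H = close ex ix L B"
  have horn_form: "horn_form B" using B(2) by (cases B) auto
  have univ: "universal_form B" and exis: "existential_form B" using B(1) by (cases B; simp)+
  show ?thesis
  proof (intro exI[of _ H] conjI allI impI)
    show "fv H = {}"
      unfolding H_def close_syntax L(1) T_def B(5) fv_lift by blast
    show "preds_pol True H \<subseteq> preds_pol True M \<inter> preds_pol True N"
    proof
      fix x assume "x \<in> preds_pol True H"
      then obtain p us s C where x: "x = ((p, length us), s)" and "C \<in> \<C>"
        "((p, us), s) \<in> clause_lits C"
        unfolding H_def close_syntax B(3) by auto
      then have "((p, us), s) \<in> LM" "((p, us), s) \<in> LN" using \<C>_lits by blast+
      then show "x \<in> preds_pol True M \<inter> preds_pol True N"
        unfolding LM_def LN_def x by (auto dest: lits_preds)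
    qed
    show "funs H \<subseteq> funs M \<inter> funs N"
      unfolding H_def close_syntax B(4) using funs_lift[of A ix] unfolding A_def by blast
    show "horn_form H" using horn_form by (simp add: H_def close_syntax)
    show "universal_form H" if "\<forall>t. \<not> ex t" using that univ by (simp add: H_def close_syntax)
    show "existential_form H" if "\<forall>t. ex t" using that exis by (simp add: H_def close_syntax)
    show "quantifier_free H" if P: "P = []" "funs M \<subseteq> funs N"
    proof -
      \<comment> \<open>With an empty prefix \<open>M\<close> is closed, so the terms in its
        instances consist of symbols of \<open>M\<close>, all of them common. Nothing is abstracted,
        and \<open>H\<close> gets no quantifiers.\<close>
      have "foreign A t = {}" if C: "C \<in> \<C>" and t: "t \<in> clause_terms C" for C t
      proof -
        obtain p us s where "t \<in> set us" "((p, us), s) \<in> clause_lits C"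
          using t by (auto simp: clause_terms_def)
        then obtain ts where "ts \<in> X" "((p, us), s) \<in> lits ((!) ts) True M"
          using \<C>_lits[OF C] by (auto simp: LM_def)
        from lits_terms[OF this(2) \<open>t \<in> set us\<close> qf(1)] obtain t'
          where "t = inst ((!) ts) t'" "fv_tm t' \<subseteq> fv M" "funs_tm t' \<subseteq> funs M" by blast
        then show ?thesis using foreign_inst[of t' A] fv(1) P by (auto simp: A_def)
      qed
      then have "L = []" using L(1) by (simp add: T_def)
      then show ?thesis using B(1) by (simp add: H_def)
    qed
  next
    fix I :: "('u, 'f, 'p) interp" and e
    assume I: "interpretation_ok I" "quantified (Dom I) P (\<lambda>us. holds I ((!) us) M) []"
    \<comment> \<open>For \<open>F \<Turnstile> H\<close>, the terms quantified universally are
      opposite; the others are computed in \<open>I\<close> with the Skolem functions of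
      \<open>F\<close> and give the existential witnesses.\<close>
    define opp where "opp t \<longleftrightarrow> \<not> shared A t \<and> \<not> ex t" for t
    have oppM: "\<forall>f ts. (f, length ts) \<in> funs M \<longrightarrow> \<not> opp (App (Inl f) ts)"
      using ex(1) by (auto simp: opp_def A_def)
    have oppP: "\<forall>i ts. i < length P \<longrightarrow> \<not> P ! i \<longrightarrow> \<not> opp (App (Inr (True, i)) ts)"
      using ex(2) by (simp add: opp_def)
    from skolem_instances[OF I qf(1) fv(1) oppM oppP]
    obtain S where S: "\<forall>i us. S i us \<in> Dom I"
      "\<forall>\<theta> ts. range \<theta> \<subseteq> Dom I \<longrightarrow> skolem_list True P ts \<longrightarrow>
        holds (herbrand (term_val I (val opp I S \<theta>))) ((!) ts) M"
      by (elim exE conjE)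
    show "holds I e H"
      unfolding H_def
    proof (rule holds_close[where opp = opp and S = S, OF I(1) S(1)[rule_format] L(3,2) ix])
      show "opp s \<longleftrightarrow> \<not> ex s" if "s \<in> set L" for s using T[OF that] by (simp add: opp_def)
      fix \<theta> e assume \<theta>: "range \<theta> \<subseteq> Dom I"
        and e: "\<And>s. s \<in> set L \<Longrightarrow> e (ix s) = val opp I S \<theta> s"
      have "\<forall>ts\<in>X. holds (herbrand (term_val I (val opp I S \<theta>))) ((!) ts) M"
        using S(2) \<theta> XY(3) by blast
      then have "\<forall>C\<in>\<C>. sat_clause (term_val I (val opp I S \<theta>)) C" using \<C>(2) by blast
      then show "holds I e B" using B_val[of opp, OF _ e] by (simp add: opp_def)
    qed
  next
    fix I :: "('u, 'f, 'p) interp" and e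
    assume I: "interpretation_ok I" and "holds I e H"
    show "quantified (Dom I) Q (\<lambda>us. holds I ((!) us) N) []"
    proof (rule ccontr)
      assume "\<not> ?thesis"
      then have Q: "quantified (Dom I) (map Not Q) (\<lambda>us. holds I ((!) us) (Neg N)) []"
        by (simp only: quantified_Neg not_False_eq_True)
      \<comment> \<open>For \<open>H \<Turnstile> G\<close>, the roles are exchanged: in a model of
        \<open>\<not> G\<close>, the universally quantified terms of \<open>H\<close> are computed
        with the Skolem functions of \<open>\<not> G\<close> and witness the dual prefix over
        \<open>Neg B\<close>.\<close>
      define opp where "opp t \<longleftrightarrow> \<not> shared A t \<and> ex t" for t
      have oppN: "\<forall>f ts. (f, length ts) \<in> funs (Neg N) \<longrightarrow> \<not> opp (App (Inl f) ts)"
        using ex(3) by (auto simp: opp_def A_def)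
      have oppQ: "\<forall>i ts. i < length (map Not Q) \<longrightarrow> \<not> map Not Q ! i \<longrightarrow>
          \<not> opp (App (Inr (False, i)) ts)"
        using ex(4) by (simp add: opp_def)
      have "quantifier_free (Neg N)" "fv (Neg N) \<subseteq> {..<length (map Not Q)}"
        using qf(2) fv(2) by simp_all
      from skolem_instances[OF I Q this oppN oppQ]
      obtain S where S: "\<forall>i us. S i us \<in> Dom I"
        "\<forall>\<theta> ts. range \<theta> \<subseteq> Dom I \<longrightarrow> skolem_list False (map Not Q) ts \<longrightarrow>
          holds (herbrand (term_val I (val opp I S \<theta>))) ((!) ts) (Neg N)"
        by (elim exE conjE)
      have "holds I e (close (\<lambda>t. \<not> ex t) ix L (Neg B))"
      proof (rule holds_close[where opp = opp and S = S, OF I S(1)[rule_format] L(3,2) ix])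
        show "opp s \<longleftrightarrow> \<not> \<not> ex s" if "s \<in> set L" for s using T[OF that] by (simp add: opp_def)
        fix \<theta> e assume \<theta>: "range \<theta> \<subseteq> Dom I"
          and e: "\<And>s. s \<in> set L \<Longrightarrow> e (ix s) = val opp I S \<theta> s"
        have "\<not> (\<exists>ts\<in>Y. holds (herbrand (term_val I (val opp I S \<theta>))) ((!) ts) N)"
          using S(2) \<theta> XY(4) by (simp only: holds.simps) blast
        then have "\<not> (\<forall>C\<in>\<C>. sat_clause (term_val I (val opp I S \<theta>)) C)"
          using \<C>(3) by blast
        then show "holds I e (Neg B)"
          using B_val[of opp, OF _ e] by (simp add: opp_def)
      qed
      then show False using \<open>holds I e H\<close> by (simp add: holds_close_Neg H_def)
    qed
  qed
qed

section \<open>From prenex formulas back to sentences\<close>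

lemma prenex_sentence:
  assumes "sentence A" "interpretation_ok I"
  shows "quantified (Dom I) (fst (prenex id 0 A)) (\<lambda>us. holds I ((!) us) (snd (prenex id 0 A))) []
    \<longleftrightarrow> holds I e A"
proof -
  have "fv A = {}" "Dom I \<noteq> {}" using assms by (simp_all add: sentence_def interpretation_ok_def)
  then show ?thesis
    using prenex_holds[of I id A 0 "[]"] holds_cong[of A "\<lambda>x. [] ! id x" e I] by simp
qed

theorem theorem2:
  fixes F G :: "('f, 'p) fm"
  assumes "infinite (UNIV :: 'u set)"
    and "sentence F" and "sentence G"
    and "horn_sentence F"
    and "entails TYPE('u) F G"
  shows "\<exists>H. craig_lyndon_interpolant TYPE('u) F G H \<and>
    horn_sentence H \<and>
    (universal_sentence F \<and> universal_sentence G \<and> funs F \<subseteq> funs G \<longrightarrow>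
       universal_sentence H) \<and>
    (existential_sentence F \<and> existential_sentence G \<and> funs G \<subseteq> funs F \<longrightarrow>
       existential_sentence H)"
proof -
  define P M where "P = fst (prenex id 0 F)" and "M = snd (prenex id 0 F)"
  define Q N where "Q = fst (prenex id 0 G)" and "N = snd (prenex id 0 G)"
  define univ where "univ \<longleftrightarrow> universal_sentence F \<and> universal_sentence G \<and> funs F \<subseteq> funs G"
  define exis where "exis \<longleftrightarrow> existential_sentence F \<and> existential_sentence G \<and> funs G \<subseteq> funs F"
  have fvFG: "fv F = {}" "fv G = {}" using assms(2,3) by (simp_all add: sentence_def)
  have M: "quantifier_free M" "funs M = funs F" "preds_pol True M = preds_pol True F"
    and N: "quantifier_free N" "funs N = funs G" "preds_pol True N = preds_pol True G"
    by (simp_all add: M_def N_def prenex_syntax)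
  have horn: "horn_matrix M"
    using assms(4) prenex_horn[of F id 0] by (simp add: M_def horn_sentence_def)
  have fv: "fv M \<subseteq> {..<length P}" "fv N \<subseteq> {..<length Q}"
    using prenex_fv[of id F 0] prenex_fv[of id G 0] fvFG by (simp_all add: M_def N_def P_def Q_def)
  have P_holds: "quantified (Dom I) P (\<lambda>us. holds I ((!) us) M) [] \<longleftrightarrow> holds I e F"
    and Q_holds: "quantified (Dom I) Q (\<lambda>us. holds I ((!) us) N) [] \<longleftrightarrow> holds I e G"
    if "interpretation_ok I" for I :: "('u, 'f, 'p) interp" and e
    using prenex_sentence[OF assms(2) that] prenex_sentence[OF assms(3) that]
    by (simp_all add: P_def M_def Q_def N_def)
  \<comment> \<open>Herbrand interpretations have their domain in \<open>'f sk tm\<close>, so the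
    entailment assumed over the infinite type \<open>'u\<close> is transferred to this type by
    \<open>entails_all\<close>.\<close>
  have entails: "\<forall>I :: ('f sk tm, 'f, 'p) interp. interpretation_ok I \<longrightarrow>
      quantified (Dom I) P (\<lambda>us. holds I ((!) us) M) [] \<longrightarrow>
      quantified (Dom I) Q (\<lambda>us. holds I ((!) us) N) []"
  proof (intro allI impI)
    fix I :: "('f sk tm, 'f, 'p) interp"
    assume I: "interpretation_ok I" "quantified (Dom I) P (\<lambda>us. holds I ((!) us) M) []"
    obtain d where d: "range (\<lambda>_::nat. d) \<subseteq> Dom I"
      using I(1) by (auto simp: interpretation_ok_def)
    have "holds I (\<lambda>_. d) F"
      using I(2) prenex_sentence[OF assms(2) I(1)] by (simp add: P_def M_def)
    from entails_all[OF assms(1,5) I(1) d this]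
    show "quantified (Dom I) Q (\<lambda>us. holds I ((!) us) N) []"
      using prenex_sentence[OF assms(3) I(1)] by (simp add: Q_def N_def)
  qed
  \<comment> \<open>Under the hypotheses of (2) no Skolem functions arise from \<open>F\<close>,
    under those of (3) none from \<open>\<not> G\<close>. Together with the inclusions of function
    symbols, this makes a constant \<open>ex\<close> admissible.\<close>
  have P_nth: "P ! i" if "univ" "i < length P" for i
    using prenex_universal[of F id 0] nth_mem[OF that(2)] that(1)
    by (auto simp: univ_def universal_sentence_def P_def)
  have Q_nth: "\<not> Q ! i" if "exis" "i < length Q" for i
    using prenex_existential[of G id 0] nth_mem[OF that(2)] that(1)
    by (auto simp: exis_def existential_sentence_def Q_def)
  \<comment> \<open>Variables, and symbols that occur in neither formula, may be quantified either way.\<close>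
  define ex :: "'f sk tm \<Rightarrow> bool" where "ex t \<longleftrightarrow> \<not> univ \<and>
    (exis \<or> (case t of App (Inl f) ts \<Rightarrow> (f, length ts) \<in> funs F | App (Inr (b, i)) ts \<Rightarrow> b | _ \<Rightarrow> True))"
    for t
  have ex: "\<forall>f ts. (f, length ts) \<in> funs M - funs N \<longrightarrow> ex (App (Inl f) ts)"
    "\<forall>i ts. i < length P \<longrightarrow> \<not> P ! i \<longrightarrow> ex (App (Inr (True, i)) ts)"
    "\<forall>f ts. (f, length ts) \<in> funs N - funs M \<longrightarrow> \<not> ex (App (Inl f) ts)"
    "\<forall>i ts. i < length Q \<longrightarrow> Q ! i \<longrightarrow> \<not> ex (App (Inr (False, i)) ts)"
    using P_nth Q_nth by (auto simp: ex_def M(2) N(2) univ_def exis_def)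
  from prenex_interpolation[where 'u = 'u, OF M(1) N(1) horn fv entails ex]
  obtain H where H: "fv H = {}" "preds_pol True H \<subseteq> preds_pol True M \<inter> preds_pol True N"
    "funs H \<subseteq> funs M \<inter> funs N" "horn_form H"
    "(\<forall>t. \<not> ex t) \<longrightarrow> universal_form H" "(\<forall>t. ex t) \<longrightarrow> existential_form H"
    "P = [] \<longrightarrow> funs M \<subseteq> funs N \<longrightarrow> quantifier_free H"
    "\<forall>(I :: ('u, 'f, 'p) interp) e. interpretation_ok I \<longrightarrow>
      quantified (Dom I) P (\<lambda>us. holds I ((!) us) M) [] \<longrightarrow> holds I e H"
    "\<forall>(I :: ('u, 'f, 'p) interp) e. interpretation_ok I \<longrightarrow> holds I e H \<longrightarrow>
      quantified (Dom I) Q (\<lambda>us. holds I ((!) us) N) []"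
    by (elim exE conjE)
  have "entails TYPE('u) F H"
    unfolding entails_def
  proof (intro allI impI)
    fix I :: "('u, 'f, 'p) interp" and e
    assume I: "interpretation_ok I" and "holds I e F"
    then show "holds I e H" using H(8) P_holds[OF I, of e] by simp
  qed
  moreover have "entails TYPE('u) H G"
    unfolding entails_def
  proof (intro allI impI)
    fix I :: "('u, 'f, 'p) interp" and e
    assume I: "interpretation_ok I" and "holds I e H"
    then have "quantified (Dom I) Q (\<lambda>us. holds I ((!) us) N) []"
      using H(9)[THEN spec, THEN spec, THEN mp, THEN mp] by blast
    then show "holds I e G" using Q_holds[OF I] by simp
  qed
  ultimately have "craig_lyndon_interpolant TYPE('u) F G H"
    using H(1-3) by (simp add: craig_lyndon_interpolant_def sentence_def preds_def M N)
  moreover have "horn_sentence H" using H(1,4) by (simp add: horn_sentence_def sentence_def)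
  moreover have "universal_sentence H" if univ
    using H(1,5) that by (simp add: universal_sentence_def sentence_def ex_def)
  moreover have "existential_sentence H" if exis
  \<comment> \<open>If the hypotheses of (2) hold as well, \<open>ex\<close> is constantly
    \<open>False\<close> and its prefix would be universal. But then \<open>F\<close> is both
    universal and existential, hence quantifier-free, and so is \<open>H\<close>.\<close>
  proof (cases univ)
    case True
    have "universal_form F" "existential_form F"
      using True that
      by (simp_all add: univ_def exis_def universal_sentence_def existential_sentence_def)
    then have "quantifier_free F" by (cases F) auto
    then have "P = []" by (simp add: P_def prenex_syntax)
    then have "quantifier_free H" using H(7) True by (simp add: univ_def M N)
    then have "existential_form H" by (cases H) auto
    then show ?thesis using H(1) by (simp add: existential_sentence_def sentence_def)
  next
    case False
    then show ?thesis
      using H(1,6) that by (simp add: existential_sentence_def sentence_def ex_def)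
  qed
  ultimately show ?thesis unfolding univ_def exis_def by (intro exI[of _ H] conjI impI)
qed

end
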